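(* Let $\mathcal T$ be a finite rooted tree with at least one edge whose nodes are labelled by pairwise distinct letters, and let $E$ be a construct of the hypergraph $\mathbb G(\mathcal T)$ all of whose node labels are singletons except exactly one, which is a two-element set $\{u,v\}$. Let $V_u$ (resp. $V_v$) be the construction with $V_u\le E$ (resp. $V_v\le E$) in which the node labelled $\{u\}$ is the parent of the node labelled $\{v\}$ (resp. the node $\{v\}$ is the parent of $\{u\}$). Then: (i) if the shortest path between $u$ and $v$ in $\mathbb G(\mathcal T)$ consists only of solid edges, then $u$ and $v$ have different levels, and, naming them so that the level of $u$ is smaller than the level of $v$, the word $\Phi^{-1}(V_u)$ is obtained from $\Phi^{-1}(V_v)$ by replacing one occurrence of a subword of the form $(s_1s_2)s_3$ by $s_1(s_2s_3)$, where $s_1,s_2,s_3$ are fully parenthesised words; (ii) otherwise (the shortest path contains a dashed edge), one of the words $\Phi^{-1}(V_u),\Phi^{-1}(V_v)$ is obtained from the other by replacing one occurrence of a subword of the form $(s_1s_2)s_3$ by $(s_1s_3)s_2$, where $s_1,s_2,s_3$ are fully parenthesised words.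
   Context: Hypergraphs: a hypergraph on a finite set $H$ is a set $\mathbf H\subseteq\mathcal P(H)\setminus\{\emptyset\}$ with $\bigcup\mathbf H=H$, atomic if it contains all singletons. $\mathbf H_X=\{Z\in\mathbf H:Z\subseteq X\}$; $\mathbf H$ is connected if there is no partition of $H$ into two non-empty disjoint $X_1,X_2$ with $\mathbf H=\mathbf H_{X_1}\cup\mathbf H_{X_2}$; $\mathbf H,X\leadsto H_1,\dots,H_n$ means $H_1,\dots,H_n$ are the connected components of $\mathbf H_{H\setminus X}$, and $\mathbf H_i=\mathbf H_{H_i}$. Constructs of a connected $\mathbf H$: for non-empty $Y\subseteq H$, if $Y=H$ the one-node tree labelled $H$ is a construct; otherwise if $\mathbf H,Y\leadsto H_1,\dots,H_n$ and $T_i$ are constructs of $\mathbf H_i$, the rooted tree $Y(T_1,\dots,T_n)$ (root labelled $Y$, unordered subtrees $T_i$) is a construct. A construction is a construct with all labels singletons. The order $\le$ on constructs is the smallest reflexive transitive relation such that $Y(X(T_{11},\dots,T_{1m}),T_2,\dots,T_n)\le (Y\cup X)(T_{11},\dots,T_{1m},T_2,\dots,T_n)$ whenever $\mathbf H,Y\leadsto K_1,\dots,K_n$, $\emptyset\ne X\subseteq K_1$, $\mathbf K_1,X\leadsto H_{11},\dots,H_{1m}$ (with $T_{1j}$, $T_i$ constructs of $\mathbf H_{1j}$, $\mathbf K_i$), and such that $Y(T_1,T_2,\dots,T_n)\le Y(T_1',T_2,\dots,T_n)$ whenever $T_1\le T_1'$ in $\mathbf H_1$ (where $\mathbf H,Y\leadsto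 H_1,\dots,H_n$). It is known that for $E$ as in the claim there are exactly two constructions below $E$, namely $V_u$ and $V_v$ as described. The graph $\mathbb G(\mathcal T)$: its vertices are the edges of $\mathcal T$; two vertices are adjacent iff, as edges of $\mathcal T$, they share a node. It is viewed as the atomic hypergraph consisting of all singletons and all adjacent pairs; it is connected. The level of a vertex $e$ is the depth in $\mathcal T$ of the child endpoint of $e$ (root has depth $0$). An edge $\{e,f\}$ of $\mathbb G(\mathcal T)$ is solid if the common node of $e,f$ is the child endpoint of one and the parent endpoint of the other (levels differ by $1$), and dashed if it is the parent endpoint of both (same level). Between any two vertices there is a unique shortest path. Words: fully parenthesised words over the letters of $\mathcal T$ are given by $w::=a\mid (ww)$. For a tree $\mathcal S$ whose nodes are distinct letters, a letter $a$ is admissible for the one-node tree $a$, and $(w_1w_2)$ is admissible for $\mathcal S$ if there is an edge $x$ of $\mathcal S$ such that, deleting $x$, $w_1$ is admissible for the component $\mathcal S_1$ containing the root of $\mathcal S$ and $w_2$ is admissible for the component $\mathcal S_2$ (the subtree rooted at the child endpoint of $x$); $x$ is the grafting edge. For an admissible word $w=(w_1w_2)$ for a subtree $\mathcal S$ of $\mathcal T$ with grafting edge $x$, define $\Phi(w)=x(\Phi(w_1),\Phi(w_2))$, where $\Phi(w_i)$ is omitted when $w_i$ is a single letter. $\Phi$ is a bijection from the words admissible for $\mathcal T$ onto the constructions of $\mathbb G(\mathcal T)$ (labels $x$ written for $\{x\}$). *)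

theory Defs
  imports Main "HOL-Library.FSet"
begin

text \<open>A hypergraph is given by its set of hyperedges; the set it lives on is the union of these.\<close>

definition hypergraph :: "'v set set \<Rightarrow> bool" where
  "hypergraph HH \<longleftrightarrow> finite (\<Union>HH) \<and> {} \<notin> HH"

definition hrestrict :: "'v set set \<Rightarrow> 'v set \<Rightarrow> 'v set set" where
  "hrestrict HH X = {Z \<in> HH. Z \<subseteq> X}"

definition hconnected :: "'v set set \<Rightarrow> bool" where
  "hconnected HH \<longleftrightarrow>
     \<not> (\<exists>X1 X2. X1 \<noteq> {} \<and> X2 \<noteq> {} \<and> X1 \<inter> X2 = {} \<and> X1 \<union> X2 = \<Union>HH \<and>
                HH = hrestrict HH X1 \<union> hrestrict HH X2)"

text \<open>The condition \<open>\<Union>(hrestrict HH K) = K\<close> makes the restriction a hypergraph on \<open>K\<close>;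
  it holds automatically when \<open>HH\<close> is atomic.\<close>

definition connected_subset :: "'v set set \<Rightarrow> 'v set \<Rightarrow> bool" where
  "connected_subset HH K \<longleftrightarrow>
     K \<noteq> {} \<and> \<Union>(hrestrict HH K) = K \<and> hconnected (hrestrict HH K)"

definition components :: "'v set set \<Rightarrow> 'v set set" where
  "components HH =
     {K. connected_subset HH K \<and> (\<forall>K'. connected_subset HH K' \<and> K \<subseteq> K' \<longrightarrow> K' = K)}"

text \<open>\<open>HH, X \<leadsto> H\<^sub>1, \<dots>, H\<^sub>n\<close> is rendered as \<open>comps_without HH X = {H\<^sub>1, \<dots>, H\<^sub>n}\<close>.\<close>

definition comps_without :: "'v set set \<Rightarrow> 'v set \<Rightarrow> 'v set set" where
  "comps_without HH X = components (hrestrict HH (\<Union>HH - X))"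

text \<open>Rooted trees with unordered subtrees. Finite sets of subtrees (rather than multisets)
  suffice: sibling subtrees of a construct carry disjoint non-empty labels, hence are distinct.\<close>

datatype (labels: 'l) ltree = Node (root_label: 'l) (subtrees: "'l ltree fset")

inductive construct :: "'v set set \<Rightarrow> 'v set ltree \<Rightarrow> bool" where
  whole: "\<lbrakk>hypergraph HH; hconnected HH; \<Union>HH \<noteq> {}\<rbrakk>
    \<Longrightarrow> construct HH (Node (\<Union>HH) {||})"
| branch: "\<lbrakk>hypergraph HH; hconnected HH; Y \<noteq> {}; Y \<subset> \<Union>HH;
     \<forall>K \<in> comps_without HH Y. construct (hrestrict HH K) (f K);
     fset Ts = f ` comps_without HH Y\<rbrakk>
    \<Longrightarrow> construct HH (Node Y Ts)"

definition construction :: "'v set set \<Rightarrow> 'v set ltree \<Rightarrow> bool" where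
  "construction HH C \<longleftrightarrow> construct HH C \<and> (\<forall>L \<in> labels C. is_singleton L)"

inductive construct_le :: "'v set set \<Rightarrow> 'v set ltree \<Rightarrow> 'v set ltree \<Rightarrow> bool" where
  refl: "construct HH C \<Longrightarrow> construct_le HH C C"
| trans: "\<lbrakk>construct_le HH C1 C2; construct_le HH C2 C3\<rbrakk> \<Longrightarrow> construct_le HH C1 C3"
| contract: "\<lbrakk>hypergraph HH; hconnected HH; Y \<noteq> {}; Y \<subset> \<Union>HH;
     K1 \<in> comps_without HH Y; X \<noteq> {}; X \<subseteq> K1;
     \<forall>J \<in> comps_without (hrestrict HH K1) X. construct (hrestrict HH J) (g J);
     fset Ts1 = g ` comps_without (hrestrict HH K1) X;
     \<forall>K \<in> comps_without HH Y - {K1}. construct (hrestrict HH K) (f K);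
     fset Ts = f ` (comps_without HH Y - {K1})\<rbrakk>
    \<Longrightarrow> construct_le HH (Node Y (finsert (Node X Ts1) Ts)) (Node (Y \<union> X) (Ts1 |\<union>| Ts))"
| cong: "\<lbrakk>hypergraph HH; hconnected HH; Y \<noteq> {}; Y \<subset> \<Union>HH;
     K1 \<in> comps_without HH Y; construct_le (hrestrict HH K1) C C';
     \<forall>K \<in> comps_without HH Y - {K1}. construct (hrestrict HH K) (f K);
     fset Ts = f ` (comps_without HH Y - {K1})\<rbrakk>
    \<Longrightarrow> construct_le HH (Node Y (finsert C Ts)) (Node Y (finsert C' Ts))"

inductive subtree_of :: "'l ltree \<Rightarrow> 'l ltree \<Rightarrow> bool" where
  self: "subtree_of t t"
| below: "\<lbrakk>s |\<in>| ts; subtree_of r s\<rbrakk> \<Longrightarrow> subtree_of r (Node l ts)"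

definition parent_label :: "'l ltree \<Rightarrow> 'l \<Rightarrow> 'l \<Rightarrow> bool" where
  "parent_label t k l \<longleftrightarrow> (\<exists>ts s. subtree_of (Node k ts) t \<and> s |\<in>| ts \<and> root_label s = l)"

text \<open>The nodes are the letters themselves. An edge is a pair (parent endpoint, child endpoint).\<close>

record 'a rtree =
  nodes :: "'a set"
  root :: 'a
  edges :: "('a \<times> 'a) set"

definition rooted_tree :: "'a rtree \<Rightarrow> bool" where
  "rooted_tree T \<longleftrightarrow>
     finite (nodes T) \<and> root T \<in> nodes T \<and> edges T \<subseteq> nodes T \<times> nodes T \<and>
     (\<forall>p. (p, root T) \<notin> edges T) \<and>
     (\<forall>a \<in> nodes T - {root T}. \<exists>!p. (p, a) \<in> edges T) \<and>
     (\<forall>a \<in> nodes T. (root T, a) \<in> (edges T)\<^sup>*)"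

definition depth :: "'a rtree \<Rightarrow> 'a \<Rightarrow> nat" where
  "depth T a = (LEAST n. (root T, a) \<in> edges T ^^ n)"

definition level :: "'a rtree \<Rightarrow> 'a \<times> 'a \<Rightarrow> nat" where
  "level T e = depth T (snd e)"

definition adjacent :: "'a \<times> 'a \<Rightarrow> 'a \<times> 'a \<Rightarrow> bool" where
  "adjacent e f \<longleftrightarrow> e \<noteq> f \<and> {fst e, snd e} \<inter> {fst f, snd f} \<noteq> {}"

definition edge_graph :: "'a rtree \<Rightarrow> ('a \<times> 'a) set set" where
  "edge_graph T =
     {{e} | e. e \<in> edges T} \<union> {{e, f} | e f. e \<in> edges T \<and> f \<in> edges T \<and> adjacent e f}"

definition solid :: "'a \<times> 'a \<Rightarrow> 'a \<times> 'a \<Rightarrow> bool" where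
  "solid e f \<longleftrightarrow> snd e = fst f \<or> snd f = fst e"

definition is_path :: "'a rtree \<Rightarrow> 'a \<times> 'a \<Rightarrow> 'a \<times> 'a \<Rightarrow> ('a \<times> 'a) list \<Rightarrow> bool" where
  "is_path T e f p \<longleftrightarrow>
     p \<noteq> [] \<and> hd p = e \<and> last p = f \<and> set p \<subseteq> edges T \<and> successively adjacent p"

definition is_shortest_path :: "'a rtree \<Rightarrow> 'a \<times> 'a \<Rightarrow> 'a \<times> 'a \<Rightarrow> ('a \<times> 'a) list \<Rightarrow> bool" where
  "is_shortest_path T e f p \<longleftrightarrow>
     is_path T e f p \<and> (\<forall>q. is_path T e f q \<longrightarrow> length p \<le> length q)"

datatype 'a pword = Letter 'a | Juxt "'a pword" "'a pword"

text \<open>The tree of everything reachable from \<open>r\<close> along \<open>B\<close>. When \<open>B\<close> arises by deleting an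
  edge of a rooted tree and \<open>r\<close> is the old root or the child endpoint of the deleted edge,
  this is the connected component of \<open>r\<close>.\<close>

definition tree_from :: "('a \<times> 'a) set \<Rightarrow> 'a \<Rightarrow> 'a rtree" where
  "tree_from B r = \<lparr>nodes = B\<^sup>* `` {r}, root = r, edges = {(p, c) \<in> B. (r, p) \<in> B\<^sup>*}\<rparr>"

definition upper_part :: "'a rtree \<Rightarrow> 'a \<times> 'a \<Rightarrow> 'a rtree" where
  "upper_part S x = tree_from (edges S - {x}) (root S)"

definition lower_part :: "'a rtree \<Rightarrow> 'a \<times> 'a \<Rightarrow> 'a rtree" where
  "lower_part S x = tree_from (edges S - {x}) (snd x)"

primrec admissible :: "'a pword \<Rightarrow> 'a rtree \<Rightarrow> bool" where
  "admissible (Letter a) S \<longleftrightarrow> S = \<lparr>nodes = {a}, root = a, edges = {}\<rparr>"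
| "admissible (Juxt w1 w2) S \<longleftrightarrow>
     (\<exists>x \<in> edges S. admissible w1 (upper_part S x) \<and> admissible w2 (lower_part S x))"

definition grafting_edge :: "'a rtree \<Rightarrow> 'a pword \<Rightarrow> 'a pword \<Rightarrow> 'a \<times> 'a" where
  "grafting_edge S w1 w2 =
     (THE x. x \<in> edges S \<and> admissible w1 (upper_part S x) \<and> admissible w2 (lower_part S x))"

text \<open>The second argument is the tree for which the word is admissible. Single letters
  have no image under \<open>\<Phi>\<close>; they are omitted as subtrees.\<close>

primrec Phi :: "'a pword \<Rightarrow> 'a rtree \<Rightarrow> ('a \<times> 'a) set ltree" where
  "Phi (Letter a) S = undefined"
| "Phi (Juxt w1 w2) S =
     (let x = grafting_edge S w1 w2 in
        Node {x}
          ((case w1 of Letter a \<Rightarrow> {||} | Juxt w w' \<Rightarrow> {|Phi w1 (upper_part S x)|}) |\<union>|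
           (case w2 of Letter a \<Rightarrow> {||} | Juxt w w' \<Rightarrow> {|Phi w2 (lower_part S x)|})))"

definition Phi_inv :: "'a rtree \<Rightarrow> ('a \<times> 'a) set ltree \<Rightarrow> 'a pword" where
  "Phi_inv T = inv_into {w. admissible w T} (\<lambda>w. Phi w T)"

inductive replace_one ::
  "('a pword \<Rightarrow> 'a pword \<Rightarrow> bool) \<Rightarrow> 'a pword \<Rightarrow> 'a pword \<Rightarrow> bool" for R where
  here: "R s t \<Longrightarrow> replace_one R s t"
| left: "replace_one R s t \<Longrightarrow> replace_one R (Juxt s w) (Juxt t w)"
| right: "replace_one R s t \<Longrightarrow> replace_one R (Juxt w s) (Juxt w t)"

inductive assoc_rule :: "'a pword \<Rightarrow> 'a pword \<Rightarrow> bool" where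
  "assoc_rule (Juxt (Juxt s1 s2) s3) (Juxt s1 (Juxt s2 s3))"

inductive exchange_rule :: "'a pword \<Rightarrow> 'a pword \<Rightarrow> bool" where
  "exchange_rule (Juxt (Juxt s1 s2) s3) (Juxt (Juxt s1 s3) s2)"

end

theory Submission
  imports Defs
begin

text \<open>
  Every construct below \<open>E\<close> other than \<open>E\<close> itself arises by splitting the node \<open>{u, v}\<close> into a
  node with label \<open>{u}\<close> above one with label \<open>{v}\<close>, or conversely. Removing an edge \<open>x\<close> from a tree
  leaves exactly two components of the hypergraph, the edge sets of the upper and the lower part,
  so \<open>\<Phi>\<close> is injective and surjective part by part, and the comparison of the two words reduces to
  the subtree in which the node \<open>{u, v}\<close> is the root. There \<open>u\<close> and \<open>v\<close> cut the tree into three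
  parts. If \<open>v\<close> lies below \<open>u\<close>, the words are \<open>s\<^sub>1(s\<^sub>2s\<^sub>3)\<close> and \<open>(s\<^sub>1s\<^sub>2)s\<^sub>3\<close>; if neither lies below the
  other, they are \<open>(s\<^sub>1s\<^sub>2)s\<^sub>3\<close> and \<open>(s\<^sub>1s\<^sub>3)s\<^sub>2\<close>. A shortest path is solid exactly in the first
  situation, because a solid shortest path never changes its vertical direction.
\<close>

section \<open>Rooted trees\<close>

text \<open>Chains in the order cause no trouble: a construct whose labels are all singletons has
  nothing else below it, so a chain ending in \<open>E\<close> has at most one strict step. Which of
  the two splits it is follows from the parent relation, which is antisymmetric on constructs. The
  main obstacle is that subtrees are unordered: a child of a node does not tell whether it encodes
  the left or the right factor of the word. It is located by its labels, because the labels of the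
  image of a word cover exactly the edges of its tree and the two parts have disjoint edge sets.
  \<open>Phi_opt\<close> turns an image into a set of at most one tree, so that single letters need
  no separate treatment and equal unions of images can be cancelled part by part. The word
  comparison is proved in a subtree and carried up to \<open>T\<close>. The position of
  \<open>u\<close> and \<open>v\<close> must survive this passage. "Neither is below the other" is a
  negation and does not transfer along an inclusion of edge sets; hence the existential
  \<open>diverge\<close>.\<close>

lemma rooted_tree_parent_unique:
  assumes "rooted_tree T" "(p, c) \<in> edges T" "(q, c) \<in> edges T"
  shows "p = q"
  using assms unfolding rooted_tree_def by (metis DiffI SigmaD2 singletonD subsetD)

lemma rooted_tree_edge_nodes:
  assumes "rooted_tree T" "(p, c) \<in> edges T"
  shows "p \<in> nodes T" "c \<in> nodes T" "c \<noteq> root T"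
  using assms unfolding rooted_tree_def by auto

lemma rooted_tree_reach:
  assumes "rooted_tree T" "a \<in> nodes T"
  shows "(root T, a) \<in> (edges T)\<^sup>*"
  using assms unfolding rooted_tree_def by auto

lemma rooted_tree_finite_edges:
  assumes "rooted_tree T"
  shows "finite (edges T)"
  using assms unfolding rooted_tree_def by (meson finite_SigmaI finite_subset)

text \<open>Every walk to \<open>c\<close> must end with its unique incoming edge, so the walks to
  \<open>c\<close> are those to \<open>p\<close> prolonged by one step and the least length shifts
  by one.\<close>

lemma depth_child:
  assumes T: "rooted_tree T" and pc: "(p, c) \<in> edges T"
  shows "depth T c = Suc (depth T p)"
proof -
  have iff: "(root T, c) \<in> edges T ^^ Suc n \<longleftrightarrow> (root T, p) \<in> edges T ^^ n" for n
    unfolding relpow.simps using rooted_tree_parent_unique[OF T _ pc] pc by blast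
  have no0: "(root T, c) \<notin> edges T ^^ 0"
    using rooted_tree_edge_nodes(3)[OF T pc] by auto
  have "(root T, p) \<in> (edges T)\<^sup>*"
    using rooted_tree_reach[OF T] rooted_tree_edge_nodes(1)[OF T pc] by blast
  then obtain m where "(root T, p) \<in> edges T ^^ m"
    using rtrancl_imp_relpow by blast
  then have "(root T, c) \<in> edges T ^^ Suc m" using iff by blast
  from Least_Suc[of "\<lambda>n. (root T, c) \<in> edges T ^^ n", OF this no0]
  show ?thesis unfolding depth_def iff .
qed

text \<open>This is the form in which acyclicity is used below: two distinct nodes cannot reach each
  other.\<close>

lemma depth_rtrancl:
  assumes T: "rooted_tree T" and "(a, b) \<in> (edges T)\<^sup>*"
  shows "a = b \<or> depth T a < depth T b"
  using assms(2) by induction (auto dest: depth_child[OF T])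

text \<open>Walking upwards is deterministic, so two walks into \<open>c\<close> share their last
  edges until one of them is exhausted.\<close>

lemma ancestors_chain:
  assumes T: "rooted_tree T" and "(a, c) \<in> (edges T)\<^sup>*" "(b, c) \<in> (edges T)\<^sup>*"
  shows "(a, b) \<in> (edges T)\<^sup>* \<or> (b, a) \<in> (edges T)\<^sup>*"
  using assms(2,3)
proof (induction arbitrary: b)
  case (step y z)
  from step.prems show ?case
  proof (cases rule: rtranclE)
    case base
    then show ?thesis using step.hyps by (meson rtrancl.rtrancl_into_rtrancl)
  next
    case (step y')
    then show ?thesis using step.hyps \<open>(y, z) \<in> edges T\<close> step.IH rooted_tree_parent_unique[OF T] by blast
  qed
qed auto

lemma rooted_tree_no_edges:
  assumes T: "rooted_tree T" and "edges T = {}"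
  shows "T = \<lparr>nodes = {root T}, root = root T, edges = {}\<rparr>"
proof -
  have "nodes T = {root T}"
    using T assms(2) unfolding rooted_tree_def by auto
  then show ?thesis using assms(2) by (cases T) auto
qed

section \<open>Subtrees obtained by deleting edges\<close>

lemma edges_tree_from: "edges (tree_from B r) = {(p, c) \<in> B. (r, p) \<in> B\<^sup>*}"
  and root_tree_from [simp]: "root (tree_from B r) = r"
  and nodes_tree_from: "nodes (tree_from B r) = B\<^sup>* `` {r}"
  by (auto simp: tree_from_def)

text \<open>A walk in \<open>B - Y\<close> that starts at a point reachable from \<open>r\<close>
  never leaves the tree cut out from \<open>r\<close>. Deducing both facts from either one makes
  this an equivalence between the two kinds of walk.\<close>

lemma rtrancl_edges_tree_from:
  assumes "(r, a) \<in> B\<^sup>*" "(a, b) \<in> (edges (tree_from B r) - Y)\<^sup>* \<or> (a, b) \<in> (B - Y)\<^sup>*"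
  shows "(a, b) \<in> (edges (tree_from B r) - Y)\<^sup>* \<and> (a, b) \<in> (B - Y)\<^sup>*"
proof -
  have "(a, b) \<in> (edges (tree_from B r) - Y)\<^sup>* \<and> (r, b) \<in> B\<^sup>*" if "(a, b) \<in> (B - Y)\<^sup>*"
    using that
  proof induction
    case (step y z)
    then have "(y, z) \<in> edges (tree_from B r) - Y" by (auto simp: edges_tree_from)
    then show ?case using step by (meson DiffD1 rtrancl.rtrancl_into_rtrancl)
  qed (use assms in auto)
  moreover have "(edges (tree_from B r) - Y)\<^sup>* \<subseteq> (B - Y)\<^sup>*"
    by (rule rtrancl_mono) (auto simp: edges_tree_from)
  ultimately show ?thesis using assms(2) by blast
qed

text \<open>Two successive cuts become one cut with both edge sets deleted; since deletion is
  commutative, all comparisons of double cuts reduce to this.\<close>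

lemma tree_from_tree_from:
  assumes "(r, r') \<in> B\<^sup>*"
  shows "tree_from (edges (tree_from B r) - Y) r' = tree_from (B - Y) r'"
proof -
  have *: "(r', b) \<in> (edges (tree_from B r) - Y)\<^sup>* \<longleftrightarrow> (r', b) \<in> (B - Y)\<^sup>*" for b
    using rtrancl_edges_tree_from[OF assms] by blast
  have "(r, b) \<in> B\<^sup>*" if "(r', b) \<in> (B - Y)\<^sup>*" for b
    using assms that by (meson Diff_subset in_mono rtrancl_mono rtrancl_trans)
  then have "{(p, c) \<in> edges (tree_from B r) - Y. (r', p) \<in> (B - Y)\<^sup>*} =
      {(p, c) \<in> B - Y. (r', p) \<in> (B - Y)\<^sup>*}"
    unfolding edges_tree_from by blast
  then show ?thesis
    by (simp only: tree_from_def[of "edges (tree_from B r) - Y"] tree_from_def[of "B - Y"] Image_singleton *)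
qed

text \<open>A walk using \<open>y\<close> would first have to arrive at \<open>fst y\<close> without
  it.\<close>

lemma tree_from_delete_unreachable:
  assumes "(r, fst y) \<notin> (B - {y})\<^sup>*"
  shows "tree_from (B - {y}) r = tree_from B r"
proof -
  have "(r, b) \<in> (B - {y})\<^sup>*" if "(r, b) \<in> B\<^sup>*" for b
    using that
  proof induction
    case (step y' z)
    then have "(y', z) \<in> B - {y}" using assms by auto
    then show ?case using step by (meson rtrancl.rtrancl_into_rtrancl)
  qed auto
  moreover have "(B - {y})\<^sup>* \<subseteq> B\<^sup>*" by (rule rtrancl_mono) auto
  ultimately have *: "(r, b) \<in> (B - {y})\<^sup>* \<longleftrightarrow> (r, b) \<in> B\<^sup>*" for b by blast
  have "{(p, c) \<in> B - {y}. (r, p) \<in> B\<^sup>*} = {(p, c) \<in> B. (r, p) \<in> B\<^sup>*}"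
    using assms unfolding * by auto
  then show ?thesis by (simp only: tree_from_def Image_singleton *)
qed

lemma rooted_tree_tree_from:
  assumes T: "rooted_tree T" and B: "B \<subseteq> edges T" and r: "\<And>p. (p, r) \<notin> B"
  shows "rooted_tree (tree_from B r)"
proof -
  have "finite B" using B rooted_tree_finite_edges[OF T] finite_subset by blast
  \<comment> \<open>Finiteness is taken from \<open>B\<close>: every reached node other than
    \<open>r\<close> is the child endpoint of an edge of \<open>B\<close>.\<close>
  have "B\<^sup>* `` {r} \<subseteq> insert r (snd ` B)"
  proof
    fix a assume "a \<in> B\<^sup>* `` {r}"
    then have "(r, a) \<in> B\<^sup>*" by simp
    then show "a \<in> insert r (snd ` B)" by cases force+
  qed
  then have fin: "finite (B\<^sup>* `` {r})"
    using \<open>finite B\<close> by (meson finite_imageI finite_insert finite_subset)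
  have reach: "(r, a) \<in> (edges (tree_from B r))\<^sup>*" if "(r, a) \<in> B\<^sup>*" for a
    using rtrancl_edges_tree_from[of r r B a "{}"] that by auto
  have "\<exists>!p. (p, a) \<in> edges (tree_from B r)" if ra: "(r, a) \<in> B\<^sup>*" "a \<noteq> r" for a
  proof -
    obtain p where "(r, p) \<in> B\<^sup>*" "(p, a) \<in> B" using ra by (metis rtranclE)
    then have "(p, a) \<in> edges (tree_from B r)" by (simp add: edges_tree_from)
    moreover have "q = p" if "(q, a) \<in> edges (tree_from B r)" for q
      using rooted_tree_parent_unique[OF T, of q a p] that \<open>(p, a) \<in> B\<close> B
      by (auto simp: edges_tree_from)
    ultimately show ?thesis by blast
  qed
  then show ?thesis unfolding rooted_tree_def
    using fin r reach by (auto simp: edges_tree_from nodes_tree_from intro: rtrancl.rtrancl_into_rtrancl)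
qed

lemma root_parts [simp]:
  "root (upper_part S x) = root S" "root (lower_part S x) = snd x"
  by (simp_all add: upper_part_def lower_part_def)

lemma edges_upper_part:
  "edges (upper_part S x) = {e \<in> edges S - {x}. (root S, fst e) \<in> (edges S - {x})\<^sup>*}"
  and edges_lower_part:
  "edges (lower_part S x) = {e \<in> edges S - {x}. (snd x, fst e) \<in> (edges S - {x})\<^sup>*}"
  by (auto simp: upper_part_def lower_part_def edges_tree_from)

lemma nodes_upper_part: "nodes (upper_part S x) = {a. (root S, a) \<in> (edges S - {x})\<^sup>*}"
  and nodes_lower_part: "nodes (lower_part S x) = {a. (snd x, a) \<in> (edges S - {x})\<^sup>*}"
  by (auto simp: upper_part_def lower_part_def nodes_tree_from)

lemma rooted_tree_parts:
  assumes "rooted_tree S" "x \<in> edges S"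
  shows "rooted_tree (upper_part S x)" "rooted_tree (lower_part S x)"
proof -
  show "rooted_tree (upper_part S x)" unfolding upper_part_def
    using rooted_tree_edge_nodes(3)[OF assms(1)] by (intro rooted_tree_tree_from[OF assms(1)]) auto
  have "(p, snd x) \<notin> edges S - {x}" for p
    using rooted_tree_parent_unique[OF assms(1), of p "snd x" "fst x"] assms(2) by auto
  then show "rooted_tree (lower_part S x)" unfolding lower_part_def
    by (intro rooted_tree_tree_from[OF assms(1)]) auto
qed

lemma parts_nodes_disjoint:
  assumes S: "rooted_tree S" and x: "x \<in> edges S"
  shows "nodes (upper_part S x) \<inter> nodes (lower_part S x) = {}"
proof -
  let ?B = "edges S - {x}"
  \<comment> \<open>Induction away from \<open>snd x\<close>: a walk from the root to a node of the
    lower part would have to pass through its unique parent, hence go back to \<open>snd x\<close>,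
    whose only incoming edge has been deleted.\<close>
  have "(root S, a) \<notin> ?B\<^sup>*" if "(snd x, a) \<in> ?B\<^sup>*" for a
    using that
  proof induction
    case base
    show ?case
    proof
      assume "(root S, snd x) \<in> ?B\<^sup>*"
      then show False
      proof (cases rule: rtranclE)
        case base
        then show ?thesis using rooted_tree_edge_nodes(3)[OF S] x by (metis prod.collapse)
      next
        case (step y)
        then show ?thesis using rooted_tree_parent_unique[OF S, of y "snd x" "fst x"] x by auto
      qed
    qed
  next
    case (step y z)
    show ?case
    proof
      assume "(root S, z) \<in> ?B\<^sup>*"
      then show False
      proof (cases rule: rtranclE)
        case base
        then show ?thesis using rooted_tree_edge_nodes(3)[OF S] step.hyps by auto
      next
        case (step y')
        then show ?thesis
          using rooted_tree_parent_unique[OF S, of y' z y] \<open>(y, z) \<in> ?B\<close> step.IH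
            \<open>(root S, y) \<notin> ?B\<^sup>*\<close> by auto
      qed
    qed
  qed
  then show ?thesis by (auto simp: nodes_upper_part nodes_lower_part)
qed

lemma parts_nodes_cover:
  assumes S: "rooted_tree S" and "a \<in> nodes S"
  shows "a \<in> nodes (upper_part S x) \<union> nodes (lower_part S x)"
  using rooted_tree_reach[OF assms]
proof induction
  case (step y z)
  show ?case
  proof (cases "(y, z) = x")
    case False
    then have "(y, z) \<in> edges S - {x}" using step by auto
    then show ?thesis using step.IH
      by (auto simp: nodes_upper_part nodes_lower_part intro: rtrancl.rtrancl_into_rtrancl)
  qed (auto simp: nodes_lower_part)
qed (auto simp: nodes_upper_part)

lemma parts_edges_nodes:
  assumes S: "rooted_tree S" "x \<in> edges S"
  shows "e \<in> edges (upper_part S x) \<Longrightarrow> fst e \<in> nodes (upper_part S x) \<and> snd e \<in> nodes (upper_part S x)"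
    "e \<in> edges (lower_part S x) \<Longrightarrow> fst e \<in> nodes (lower_part S x) \<and> snd e \<in> nodes (lower_part S x)"
  using rooted_tree_parts[OF S] rooted_tree_edge_nodes by (metis prod.collapse)+

lemma parts_edges_disjoint:
  assumes S: "rooted_tree S" "x \<in> edges S"
  shows "edges (upper_part S x) \<inter> edges (lower_part S x) = {}"
  using parts_edges_nodes[OF S] parts_nodes_disjoint[OF S] by blast

lemma parts_edges_cover:
  assumes S: "rooted_tree S" "x \<in> edges S"
  shows "edges (upper_part S x) \<union> edges (lower_part S x) = edges S - {x}"
proof -
  have "(root S, p) \<in> (edges S - {x})\<^sup>* \<or> (snd x, p) \<in> (edges S - {x})\<^sup>*" if "(p, c) \<in> edges S" for p c
    using parts_nodes_cover[OF S(1) rooted_tree_edge_nodes(1)[OF S(1) that], of x]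
    by (simp add: nodes_upper_part nodes_lower_part)
  then show ?thesis unfolding edges_upper_part edges_lower_part by fastforce
qed

section \<open>Relative position of two edges\<close>

lemma rtrancl_delete_edge_above:
  assumes S: "rooted_tree S" "x \<in> edges S" and "(snd x, a) \<in> (edges S)\<^sup>*"
  shows "(snd x, a) \<in> (edges S - {x})\<^sup>*"
  using assms(3)
proof induction
  case (step b c)
  \<comment> \<open>The source of \<open>x\<close> is less deep than \<open>snd x\<close>, whereas
    \<open>b\<close> is at least as deep.\<close>
  have "(b, c) \<noteq> x"
    using depth_rtrancl[OF S(1) step.hyps(1)] depth_child[OF S(1), of b c] S(2) by auto
  then show ?case using step by (metis Diff_iff rtrancl.rtrancl_into_rtrancl singletonD)
qed auto

text \<open>The walk runs from the child endpoint of \<open>u\<close> to the parent endpoint of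
  \<open>v\<close>. In a rooted tree this makes the relation strict, and the empty walk covers the
  case that \<open>v\<close> is attached directly under \<open>u\<close>.\<close>

definition below :: "'a rtree \<Rightarrow> 'a \<times> 'a \<Rightarrow> 'a \<times> 'a \<Rightarrow> bool" where
  "below S u v \<longleftrightarrow> (snd u, fst v) \<in> (edges S)\<^sup>*"

lemma below_iff_lower_part:
  assumes S: "rooted_tree S" "u \<in> edges S" "v \<in> edges S"
  shows "v \<in> edges (lower_part S u) \<longleftrightarrow> below S u v"
proof
  assume "v \<in> edges (lower_part S u)"
  then have "(snd u, fst v) \<in> (edges S - {u})\<^sup>*" by (auto simp: edges_lower_part)
  then show "below S u v" unfolding below_def by (meson Diff_subset in_mono rtrancl_mono)
next
  assume b: "below S u v"
  then have "v \<noteq> u"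
    using depth_rtrancl[OF S(1), of "snd u" "fst v"] depth_child[OF S(1), of "fst u" "snd u"] S(2)
    by (auto simp: below_def)
  then show "v \<in> edges (lower_part S u)"
    using rtrancl_delete_edge_above[OF S(1,2)] b S(3) by (auto simp: below_def edges_lower_part)
qed

lemma below_level:
  assumes "rooted_tree S" "v \<in> edges S" "below S u v"
  shows "level S u < level S v"
  using depth_rtrancl[OF assms(1), of "snd u" "fst v"] depth_child[OF assms(1), of "fst v" "snd v"] assms
  by (auto simp: below_def level_def)

text \<open>The branches to \<open>y\<close> and \<open>z\<close> leave a common ancestor
  \<open>a\<close> through different children. Being existential, this persists when edges are
  added.\<close>

definition diverge :: "'a rtree \<Rightarrow> 'a \<Rightarrow> 'a \<Rightarrow> bool" where
  "diverge S y z \<longleftrightarrow> (\<exists>a b c. (a, b) \<in> edges S \<and> (a, c) \<in> edges S \<and> b \<noteq> c \<and>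
     (b, y) \<in> (edges S)\<^sup>* \<and> (c, z) \<in> (edges S)\<^sup>*)"

lemma diverge_mono:
  assumes "edges S \<subseteq> edges S'" "diverge S y z"
  shows "diverge S' y z"
proof -
  have "(edges S)\<^sup>* \<subseteq> (edges S')\<^sup>*" using assms(1) by (rule rtrancl_mono)
  then show ?thesis using assms unfolding diverge_def by blast
qed

lemma below_mono:
  assumes "edges S \<subseteq> edges S'" "below S u v"
  shows "below S' u v"
  using rtrancl_mono[OF assms(1)] assms(2) unfolding below_def by blast

lemma diverge_sym: "diverge S y z \<Longrightarrow> diverge S z y"
  unfolding diverge_def by metis

lemma diverge_not_ancestor:
  assumes S: "rooted_tree S" and "diverge S y z"
  shows "(y, z) \<notin> (edges S)\<^sup>*"
proof
  assume yz: "(y, z) \<in> (edges S)\<^sup>*"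
  obtain a b c where abc: "(a, b) \<in> edges S" "(a, c) \<in> edges S" "b \<noteq> c"
      "(b, y) \<in> (edges S)\<^sup>*" "(c, z) \<in> (edges S)\<^sup>*"
    using assms(2) unfolding diverge_def by blast
  have "(b, z) \<in> (edges S)\<^sup>*" using abc yz by auto
  then have "(b, c) \<in> (edges S)\<^sup>* \<or> (c, b) \<in> (edges S)\<^sup>*"
    using ancestors_chain[OF S] abc by blast
  then show False
    using depth_rtrancl[OF S] abc depth_child[OF S, of a] by (metis less_irrefl)
qed

lemma tree_trichotomy:
  assumes S: "rooted_tree S" and "y \<in> nodes S" "z \<in> nodes S"
  shows "(y, z) \<in> (edges S)\<^sup>* \<or> (z, y) \<in> (edges S)\<^sup>* \<or> diverge S y z"
  \<comment> \<open>Follow the branch from the root to \<open>y\<close>. As long as it stays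
    strictly above \<open>z\<close>, the next node either remains on the branch to \<open>z\<close>
    or exhibits the divergence.\<close>
  using rooted_tree_reach[OF assms(1,2)]
proof induction
  case base
  then show ?case using rooted_tree_reach[OF assms(1,3)] by auto
next
  case (step y y')
  consider "(z, y) \<in> (edges S)\<^sup>*" | "diverge S y z" | b where "(y, b) \<in> edges S" "(b, z) \<in> (edges S)\<^sup>*"
    using step.IH by (metis converse_rtranclE rtrancl.rtrancl_refl)
  then show ?case
  proof cases
    case 1
    then show ?thesis using step.hyps by auto
  next
    case 2
    then have "diverge S y' z" unfolding diverge_def using step.hyps
      by (meson rtrancl.rtrancl_into_rtrancl)
    then show ?thesis by blast
  next
    case 3
    then show ?thesis using step.hyps unfolding diverge_def by blast
  qed
qed

lemma below_or_diverge:
  assumes S: "rooted_tree S" "u \<in> edges S" "v \<in> edges S" "u \<noteq> v"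
  shows "below S u v \<or> below S v u \<or> diverge S (snd u) (snd v)"
proof -
  \<comment> \<open>Equal child endpoints force equal edges; otherwise the last step of the walk is
    \<open>f\<close> itself, and dropping it gives \<open>below\<close>.\<close>
  have *: "below S e f" if "(snd e, snd f) \<in> (edges S)\<^sup>*" "e \<in> edges S" "f \<in> edges S" "e \<noteq> f" for e f
    using that(1)
  proof (cases rule: rtranclE)
    case base
    then have "fst e = fst f" using rooted_tree_parent_unique[OF S(1)] that by (metis prod.collapse)
    then show ?thesis using base that by (simp add: prod_eq_iff)
  next
    case (step y)
    then have "y = fst f" using rooted_tree_parent_unique[OF S(1)] that by (metis prod.collapse)
    then show ?thesis using step unfolding below_def by auto
  qed
  show ?thesis
    using tree_trichotomy[OF S(1), of "snd u" "snd v"] *[of u v] *[of v u] S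
      rooted_tree_edge_nodes(2)[OF S(1)] by (metis prod.collapse)
qed

text \<open>The two orders of cutting produce the same three trees. Each double cut deletes both
  edges from \<open>edges S\<close>, and one of the deletions has no effect when the parent endpoint
  of that edge cannot be reached from the chosen root.\<close>

lemma parts_nested:
  assumes S: "rooted_tree S" and u: "u \<in> edges S" and v: "v \<in> edges (lower_part S u)"
  shows "u \<in> edges (upper_part S v)"
    "upper_part (upper_part S v) u = upper_part S u"
    "lower_part (upper_part S v) u = upper_part (lower_part S u) v"
    "lower_part (lower_part S u) v = lower_part S v"
proof -
  let ?E = "edges S"
  have vS: "v \<in> ?E" using v by (auto simp: edges_lower_part)
  have "u \<notin> edges (lower_part S v)"
    using below_iff_lower_part[OF S] below_level[OF S] u v vS by (metis less_asym)
  moreover have "u \<noteq> v" using v by (auto simp: edges_lower_part)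
  ultimately show uU: "u \<in> edges (upper_part S v)"
    using parts_edges_cover[OF S vS] u by blast
  then have "(root S, snd u) \<in> (?E - {v})\<^sup>*"
    by (auto simp: edges_upper_part intro: rtrancl.rtrancl_into_rtrancl)
  then have "lower_part (upper_part S v) u = tree_from (?E - {v} - {u}) (snd u)"
    unfolding lower_part_def[of _ u] upper_part_def by (rule tree_from_tree_from)
  moreover have "upper_part (lower_part S u) v = tree_from (?E - {u} - {v}) (snd u)"
    unfolding upper_part_def lower_part_def by (simp add: tree_from_tree_from)
  ultimately show "lower_part (upper_part S v) u = upper_part (lower_part S u) v"
    by (simp add: Diff_insert2[symmetric] insert_commute)
  have "upper_part (upper_part S v) u = tree_from (?E - {u} - {v}) (root S)"
    unfolding upper_part_def by (simp add: tree_from_tree_from Diff_insert2[symmetric] insert_commute)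
  also have "\<dots> = tree_from (?E - {u}) (root S)"
  proof (rule tree_from_delete_unreachable, rule notI)
    assume "(root S, fst v) \<in> (?E - {u} - {v})\<^sup>*"
    moreover have "(?E - {u} - {v})\<^sup>* \<subseteq> (?E - {u})\<^sup>*" by (rule rtrancl_mono) auto
    ultimately have "v \<in> edges (upper_part S u)" using v by (auto simp: edges_upper_part edges_lower_part)
    then show False using parts_edges_disjoint[OF S u] v by blast
  qed
  finally show "upper_part (upper_part S v) u = upper_part S u" by (simp add: upper_part_def)
  have "(snd u, snd v) \<in> (?E - {u})\<^sup>*"
    using v by (auto simp: edges_lower_part intro: rtrancl.rtrancl_into_rtrancl)
  then have "lower_part (lower_part S u) v = tree_from (?E - {v} - {u}) (snd v)"
    unfolding lower_part_def by (simp add: tree_from_tree_from Diff_insert2[symmetric] insert_commute)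
  also have "\<dots> = tree_from (?E - {v}) (snd v)"
  proof (rule tree_from_delete_unreachable, rule notI)
    assume "(snd v, fst u) \<in> (?E - {v} - {u})\<^sup>*"
    moreover have "(?E - {v} - {u})\<^sup>* \<subseteq> (?E - {v})\<^sup>*" by (rule rtrancl_mono) auto
    ultimately have "u \<in> edges (lower_part S v)" using uU by (auto simp: edges_upper_part edges_lower_part)
    then show False using parts_edges_disjoint[OF S vS] uU by blast
  qed
  finally show "lower_part (lower_part S u) v = lower_part S v" by (simp add: lower_part_def)
qed

text \<open>Same principle for two edges neither of which is cut off by the other. The remaining
  identity, for the lower part at \<open>u\<close>, is the second one with \<open>u\<close> and
  \<open>v\<close> exchanged.\<close>

lemma parts_independent:
  assumes S: "rooted_tree S" and u: "u \<in> edges (upper_part S v)" and v: "v \<in> edges (upper_part S u)"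
  shows "upper_part (upper_part S u) v = upper_part (upper_part S v) u"
    "lower_part (upper_part S u) v = lower_part S v"
proof -
  let ?E = "edges S"
  have vS: "v \<in> ?E" using v by (auto simp: edges_upper_part)
  show "upper_part (upper_part S u) v = upper_part (upper_part S v) u"
    unfolding upper_part_def by (simp add: tree_from_tree_from Diff_insert2[symmetric] insert_commute)
  have "(root S, snd v) \<in> (?E - {u})\<^sup>*"
    using v by (auto simp: edges_upper_part intro: rtrancl.rtrancl_into_rtrancl)
  then have "lower_part (upper_part S u) v = tree_from (?E - {v} - {u}) (snd v)"
    unfolding lower_part_def upper_part_def
    by (simp add: tree_from_tree_from Diff_insert2[symmetric] insert_commute)
  also have "\<dots> = tree_from (?E - {v}) (snd v)"
  proof (rule tree_from_delete_unreachable, rule notI)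
    assume "(snd v, fst u) \<in> (?E - {v} - {u})\<^sup>*"
    moreover have "(?E - {v} - {u})\<^sup>* \<subseteq> (?E - {v})\<^sup>*" by (rule rtrancl_mono) auto
    ultimately have "u \<in> edges (lower_part S v)" using u by (auto simp: edges_upper_part edges_lower_part)
    then show False using parts_edges_disjoint[OF S vS] u by blast
  qed
  finally show "lower_part (upper_part S u) v = lower_part S v" by (simp add: lower_part_def)
qed

section \<open>Connected components\<close>

lemma Union_hrestrict_subset: "\<Union>(hrestrict HH X) \<subseteq> X"
  by (auto simp: hrestrict_def)

lemma hrestrict_hrestrict: "hrestrict (hrestrict HH X) Y = hrestrict HH (X \<inter> Y)"
  by (auto simp: hrestrict_def)

text \<open>The second block of a partition is the complement of the first, so connectedness can be
  tested on single sets \<open>X\<close>, each of which must be crossed by a hyperedge inside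
  \<open>K\<close>.\<close>

lemma connected_subset_iff:
  "connected_subset HH K \<longleftrightarrow> K \<noteq> {} \<and> \<Union>(hrestrict HH K) = K \<and>
     (\<forall>X. X \<noteq> {} \<and> X \<subset> K \<longrightarrow> (\<exists>Z \<in> HH. Z \<subseteq> K \<and> \<not> Z \<subseteq> X \<and> \<not> Z \<subseteq> K - X))"
proof -
  have conn: "hconnected (hrestrict HH K) \<longleftrightarrow>
      (\<forall>X. X \<noteq> {} \<and> X \<subset> K \<longrightarrow> (\<exists>Z \<in> HH. Z \<subseteq> K \<and> \<not> Z \<subseteq> X \<and> \<not> Z \<subseteq> K - X))"
    if K: "\<Union>(hrestrict HH K) = K"
  proof -
    have split: "hrestrict HH K = hrestrict (hrestrict HH K) X1 \<union> hrestrict (hrestrict HH K) X2 \<longleftrightarrow>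
        (\<forall>Z \<in> HH. Z \<subseteq> K \<longrightarrow> Z \<subseteq> X1 \<or> Z \<subseteq> X2)" for X1 X2
      unfolding hrestrict_def by blast
    have eq: "(\<exists>X1 X2. X1 \<noteq> {} \<and> X2 \<noteq> {} \<and> X1 \<inter> X2 = {} \<and> X1 \<union> X2 = K \<and>
          (\<forall>Z \<in> HH. Z \<subseteq> K \<longrightarrow> Z \<subseteq> X1 \<or> Z \<subseteq> X2)) \<longleftrightarrow>
        (\<exists>X. X \<noteq> {} \<and> X \<subset> K \<and> (\<forall>Z \<in> HH. Z \<subseteq> K \<longrightarrow> Z \<subseteq> X \<or> Z \<subseteq> K - X))" (is "?l \<longleftrightarrow> ?r")
    proof
      assume ?l
      then obtain X1 X2 where X: "X1 \<noteq> {}" "X2 \<noteq> {}" "X1 \<inter> X2 = {}" "X1 \<union> X2 = K"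
        and Z: "\<forall>Z \<in> HH. Z \<subseteq> K \<longrightarrow> Z \<subseteq> X1 \<or> Z \<subseteq> X2"
        by (elim exE conjE)
      have "X2 = K - X1" "X1 \<subset> K" using X by blast+
      then show ?r using X(1) Z by (intro exI[of _ X1]) simp
    next
      assume ?r
      then obtain X where X: "X \<noteq> {}" "X \<subset> K"
        and Z: "\<forall>Z \<in> HH. Z \<subseteq> K \<longrightarrow> Z \<subseteq> X \<or> Z \<subseteq> K - X"
        by (elim exE conjE)
      have "K - X \<noteq> {}" "X \<inter> (K - X) = {}" "X \<union> (K - X) = K" using X by blast+
      with X(1) Z show ?l by metis
    qed
    show ?thesis unfolding hconnected_def K split eq by meson
  qed
  show ?thesis unfolding connected_subset_def by (simp only: conn cong: conj_cong)
qed

lemma connected_subset_Un: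
  assumes K: "connected_subset HH K" and K': "connected_subset HH K'" and z: "z \<in> K" "z \<in> K'"
  shows "connected_subset HH (K \<union> K')"
  unfolding connected_subset_iff
proof (intro conjI allI impI)
  show "K \<union> K' \<noteq> {}" using z by blast
  have "\<Union>(hrestrict HH K) = K" "\<Union>(hrestrict HH K') = K'"
    using K K' by (simp_all only: connected_subset_def)
  moreover have "hrestrict HH K \<subseteq> hrestrict HH (K \<union> K')" "hrestrict HH K' \<subseteq> hrestrict HH (K \<union> K')"
    by (auto simp: hrestrict_def)
  ultimately show "\<Union>(hrestrict HH (K \<union> K')) = K \<union> K'"
    using Union_hrestrict_subset[of HH "K \<union> K'"] by blast
  fix X assume X: "X \<noteq> {} \<and> X \<subset> K \<union> K'"
  have crossing: "\<exists>Z \<in> HH. Z \<subseteq> K \<union> K' \<and> \<not> Z \<subseteq> X \<and> \<not> Z \<subseteq> K \<union> K' - X"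
    if "connected_subset HH M" "M \<subseteq> K \<union> K'" "M \<inter> X \<noteq> {}" "\<not> M \<subseteq> X" for M
  proof -
    have "M \<inter> X \<noteq> {} \<and> M \<inter> X \<subset> M" using that by blast
    then have "\<exists>Z \<in> HH. Z \<subseteq> M \<and> \<not> Z \<subseteq> M \<inter> X \<and> \<not> Z \<subseteq> M - M \<inter> X"
      using that(1) unfolding connected_subset_iff by meson
    then show ?thesis using that(2) by blast
  qed
  \<comment> \<open>If \<open>X\<close> cut neither set, each would lie entirely inside or entirely
    outside \<open>X\<close>; the common point \<open>z\<close> puts both on the same side, which
    contradicts the choice of \<open>X\<close>.\<close>
  consider "K \<inter> X \<noteq> {}" "\<not> K \<subseteq> X" | "K' \<inter> X \<noteq> {}" "\<not> K' \<subseteq> X"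
    using X z by blast
  then show "\<exists>Z \<in> HH. Z \<subseteq> K \<union> K' \<and> \<not> Z \<subseteq> X \<and> \<not> Z \<subseteq> K \<union> K' - X"
    using crossing K K' by cases auto
qed

lemma components_disjoint:
  assumes "K \<in> components HH" "K' \<in> components HH" "K \<noteq> K'"
  shows "K \<inter> K' = {}"
proof (rule ccontr)
  assume "K \<inter> K' \<noteq> {}"
  then obtain z where "z \<in> K" "z \<in> K'" by blast
  moreover have "connected_subset HH K" "connected_subset HH K'"
    using assms(1,2) by (simp_all add: components_def)
  ultimately have "connected_subset HH (K \<union> K')" by (intro connected_subset_Un)
  then have "K \<union> K' = K" "K \<union> K' = K'" using assms unfolding components_def by blast+
  then show False using assms by blast
qed

lemma comps_without_disjoint:
  "K \<in> comps_without HH Y \<Longrightarrow> K' \<in> comps_without HH Y \<Longrightarrow> K \<noteq> K' \<Longrightarrow> K \<inter> K' = {}"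
  unfolding comps_without_def by (rule components_disjoint)

lemma comps_without_subset:
  assumes "K \<in> comps_without HH Y"
  shows "K \<noteq> {}" "K \<subseteq> \<Union>HH - Y"
proof -
  have "connected_subset (hrestrict HH (\<Union>HH - Y)) K"
    using assms by (simp add: comps_without_def components_def)
  then have "K \<noteq> {}" "\<Union>(hrestrict HH ((\<Union>HH - Y) \<inter> K)) = K"
    by (simp_all add: connected_subset_def hrestrict_hrestrict)
  then show "K \<noteq> {}" "K \<subseteq> \<Union>HH - Y"
    using Union_hrestrict_subset[of HH "(\<Union>HH - Y) \<inter> K"] by auto
qed

lemma comps_without_all: "comps_without HH (\<Union>HH) = {}"
  using comps_without_subset[of _ HH "\<Union>HH"] by fastforce

text \<open>Treats both rules for constructs at once: the one-node tree is the case where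
  \<open>Y = \<Union>HH\<close> and no components remain.\<close>

lemma construct_induct [consumes 1, case_names construct]:
  assumes "construct HH C"
    and step: "\<And>HH Y f Ts. Y \<noteq> {} \<Longrightarrow> Y \<subseteq> \<Union>HH \<Longrightarrow>
      (\<And>K. K \<in> comps_without HH Y \<Longrightarrow> construct (hrestrict HH K) (f K)) \<Longrightarrow>
      (\<And>K. K \<in> comps_without HH Y \<Longrightarrow> P (hrestrict HH K) (f K)) \<Longrightarrow>
      fset Ts = f ` comps_without HH Y \<Longrightarrow> P HH (Node Y Ts)"
  shows "P HH C"
  using assms(1)
proof induction
  case (whole HH)
  then show ?case by (intro step) (auto simp: comps_without_all)
next
  case (branch HH Y f Ts)
  then show ?case by (intro step) auto
qed

section \<open>Labels of constructs and the parent relation\<close>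

definition labels_within :: "'v set \<Rightarrow> 'v set ltree \<Rightarrow> bool" where
  "labels_within A C \<longleftrightarrow> (\<forall>L \<in> labels C. L \<noteq> {} \<and> L \<subseteq> A)"

definition all_singletons :: "'v set ltree \<Rightarrow> bool" where
  "all_singletons C \<longleftrightarrow> (\<forall>L \<in> labels C. is_singleton L)"

lemma labels_within_mono: "labels_within A C \<Longrightarrow> A \<subseteq> B \<Longrightarrow> labels_within B C"
  unfolding labels_within_def by blast

lemma labels_within_Node:
  "labels_within A (Node Y Ts) \<longleftrightarrow> Y \<noteq> {} \<and> Y \<subseteq> A \<and> (\<forall>t \<in> fset Ts. labels_within A t)"
  unfolding labels_within_def by auto

lemma all_singletons_Node:
  "all_singletons (Node Y Ts) \<longleftrightarrow> is_singleton Y \<and> (\<forall>t \<in> fset Ts. all_singletons t)"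
  unfolding all_singletons_def by auto

lemma root_label_in_labels: "root_label t \<in> labels t"
  by (cases t) auto

text \<open>Non-emptiness of labels is essential here: a common label would be a non-empty subset of
  both \<open>A\<close> and \<open>B\<close>.\<close>

lemma labels_within_disjoint:
  assumes "labels_within A C" "labels_within B D" "A \<inter> B = {}"
  shows "labels C \<inter> labels D = {}" "C \<noteq> D"
proof -
  show *: "labels C \<inter> labels D = {}" using assms unfolding labels_within_def by fastforce
  then show "C \<noteq> D" using root_label_in_labels by blast
qed

lemma construct_labels: "construct HH C \<Longrightarrow> labels_within (\<Union>HH) C"
proof (induction rule: construct_induct)
  case (construct HH Y f Ts)
  have "labels_within (\<Union>HH) (f K)" if "K \<in> comps_without HH Y" for K
    by (rule labels_within_mono[OF construct.IH[OF that]])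
      (use comps_without_subset(2)[OF that] Union_hrestrict_subset[of HH K] in blast)
  then have "\<forall>t \<in> fset Ts. labels_within (\<Union>HH) t" unfolding construct.hyps(4) by blast
  then show ?case using construct.hyps(1,2) by (simp add: labels_within_Node)
qed

lemma construct_hrestrict_labels: "construct (hrestrict HH K) C \<Longrightarrow> labels_within K C"
  by (rule labels_within_mono[OF construct_labels Union_hrestrict_subset])

text \<open>Extracts from the premises shared by \<open>contract\<close> and \<open>cong\<close>
  what is needed about the untouched siblings: their labels avoid the root label and the active
  component \<open>K1\<close>.\<close>

lemma sibling_labels_within:
  assumes "K1 \<in> comps_without HH Y"
    and "\<forall>K \<in> comps_without HH Y - {K1}. construct (hrestrict HH K) (f K)"
    and "fset Ts = f ` (comps_without HH Y - {K1})" and "t \<in> fset Ts"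
  shows "\<exists>K. K \<subseteq> \<Union>HH - Y \<and> K \<inter> K1 = {} \<and> labels_within K t"
proof -
  obtain K where K: "K \<in> comps_without HH Y - {K1}" "t = f K"
    using assms(3,4) by auto
  have "labels_within K t" using K assms(2) construct_hrestrict_labels by blast
  moreover have "K \<subseteq> \<Union>HH - Y" using K comps_without_subset(2) by blast
  moreover have "K \<inter> K1 = {}" using K comps_without_disjoint[of K HH Y K1] assms(1) by blast
  ultimately show ?thesis by blast
qed

lemma grandchild_labels_within:
  assumes "\<forall>J \<in> comps_without (hrestrict HH K) X. construct (hrestrict HH J) (g J)"
    and "fset Ts = g ` comps_without (hrestrict HH K) X" and "t \<in> fset Ts"
  shows "labels_within (K - X) t"
proof -
  obtain J where J: "J \<in> comps_without (hrestrict HH K) X" "t = g J"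
    using assms(2,3) by auto
  have "labels_within J t" using J assms(1) construct_hrestrict_labels by blast
  moreover have "J \<subseteq> K - X"
    using comps_without_subset(2)[OF J(1)] Union_hrestrict_subset[of HH K] by blast
  ultimately show ?thesis by (rule labels_within_mono)
qed

lemma construct_le_labels:
  "construct_le HH C C' \<Longrightarrow> labels_within (\<Union>HH) C \<and> labels_within (\<Union>HH) C'"
proof (induction rule: construct_le.induct)
  case (refl HH C)
  then show ?case using construct_labels by auto
next
  case (contract HH Y K1 X g Ts1 f Ts)
  have K1: "K1 \<subseteq> \<Union>HH" using comps_without_subset(2)[OF contract(5)] by blast
  have "labels_within (\<Union>HH) t" if "t \<in> fset Ts" for t
    using sibling_labels_within[OF contract(5,10,11) that] labels_within_mono by blast
  moreover have "labels_within (\<Union>HH) t" if "t \<in> fset Ts1" for t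
    by (rule labels_within_mono[OF grandchild_labels_within[OF contract(8,9) that]]) (use K1 in blast)
  moreover have "Y \<subseteq> \<Union>HH" "X \<subseteq> \<Union>HH" using contract(4,7) K1 by blast+
  ultimately show ?case using contract(3,6) by (auto simp only: labels_within_Node finsert.rep_eq union_fset)
next
  case (cong HH Y K1 C C' f Ts)
  have "labels_within (\<Union>HH) t" if "t \<in> fset Ts" for t
    using sibling_labels_within[OF cong.hyps(5,7,8) that] labels_within_mono by blast
  moreover have "\<Union>(hrestrict HH K1) \<subseteq> \<Union>HH" by (auto simp: hrestrict_def)
  then have "labels_within (\<Union>HH) C" "labels_within (\<Union>HH) C'"
    using cong.IH labels_within_mono by blast+
  moreover have "Y \<subseteq> \<Union>HH" using cong.hyps(4) by blast
  ultimately show ?case using cong.hyps(3) by (auto simp only: labels_within_Node finsert.rep_eq)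
qed simp

lemma parent_label_Node:
  "parent_label (Node Y Ts) k l \<longleftrightarrow>
     (k = Y \<and> (\<exists>s \<in> fset Ts. root_label s = l)) \<or> (\<exists>t \<in> fset Ts. parent_label t k l)"
proof -
  have *: "subtree_of r (Node Y Ts) \<longleftrightarrow> r = Node Y Ts \<or> (\<exists>t \<in> fset Ts. subtree_of r t)" for r
    by (subst subtree_of.simps) auto
  show ?thesis unfolding parent_label_def * by fastforce
qed

lemma subtree_of_labels: "subtree_of r t \<Longrightarrow> labels r \<subseteq> labels t"
  by (induction rule: subtree_of.induct) auto

lemma parent_label_in_labels:
  assumes "parent_label t k l"
  shows "k \<in> labels t" "l \<in> labels t"
proof -
  obtain ts s where s: "subtree_of (Node k ts) t" "s \<in> fset ts" "root_label s = l"
    using assms unfolding parent_label_def by auto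
  then have "k \<in> labels (Node k ts)" "l \<in> labels (Node k ts)"
    using root_label_in_labels by auto
  then show "k \<in> labels t" "l \<in> labels t" using subtree_of_labels[OF s(1)] by auto
qed

text \<open>Labels in a child lie in a component that avoids \<open>Y\<close>, so the root label
  does not recur below; any other label determines its component, and the claim passes to that
  child. This decides the orientation of a split.\<close>

lemma construct_parent_label_asym:
  "construct HH C \<Longrightarrow> parent_label C k l \<Longrightarrow> \<not> parent_label C l k"
proof (induction rule: construct_induct)
  case (construct HH Y f Ts)
  have within: "labels_within K (f K)" if "K \<in> comps_without HH Y" for K
    using construct.hyps that construct_hrestrict_labels by blast
  have Ts: "fset Ts = f ` comps_without HH Y" by fact
  have no_root: False if kl: "parent_label (Node Y Ts) Y l'" "parent_label (Node Y Ts) l' Y" for l'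
  proof -
    have "\<exists>t \<in> fset Ts. Y \<in> labels t"
      using kl(2) parent_label_in_labels(2) root_label_in_labels unfolding parent_label_Node by fast
    then obtain K where K: "K \<in> comps_without HH Y" "Y \<in> labels (f K)"
      unfolding Ts by blast
    then have "Y \<subseteq> K" using within unfolding labels_within_def by blast
    then show False using comps_without_subset(2)[OF K(1)] construct.hyps(1) by blast
  qed
  show ?case
  proof
    assume lk: "parent_label (Node Y Ts) l k"
    have "k \<noteq> Y" "l \<noteq> Y" using no_root construct.prems lk by blast+
    then obtain K K' where K: "K \<in> comps_without HH Y" "parent_label (f K) k l"
      and K': "K' \<in> comps_without HH Y" "parent_label (f K') l k"
      using construct.prems lk unfolding parent_label_Node Ts by blast
    have "k \<in> labels (f K) \<inter> labels (f K')"
      using parent_label_in_labels(1)[OF K(2)] parent_label_in_labels(2)[OF K'(2)] by blast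
    then have "K \<inter> K' \<noteq> {}"
      using labels_within_disjoint(1)[OF within[OF K(1)] within[OF K'(1)]] by blast
    then have "K = K'" using comps_without_disjoint[OF K(1) K'(1)] by blast
    then show False using construct.IH[OF K] K'(2) by blast
  qed
qed

text \<open>The part of the order that matters below a construct whose only non-singleton label is
  \<open>{u, v}\<close>: that node is replaced by \<open>{u}\<close> with child \<open>{v}\<close>.\<close>

inductive splits :: "'v \<Rightarrow> 'v \<Rightarrow> 'v set ltree \<Rightarrow> 'v set ltree \<Rightarrow> bool" for u v where
  here: "\<lbrakk>Node {v} Ts1 |\<notin>| Ts2; \<forall>t \<in> fset (Ts1 |\<union>| Ts2). all_singletons t\<rbrakk>
    \<Longrightarrow> splits u v (Node {u} (finsert (Node {v} Ts1) Ts2)) (Node {u, v} (Ts1 |\<union>| Ts2))"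
| inside: "\<lbrakk>splits u v C C'; C |\<notin>| Ts; \<forall>t \<in> fset Ts. all_singletons t\<rbrakk>
    \<Longrightarrow> splits u v (Node {x} (finsert C Ts)) (Node {x} (finsert C' Ts))"

lemma splits_properties:
  assumes "splits u v C C'"
  shows "all_singletons C" "{u, v} \<in> labels C'" "\<Union>(labels C) = \<Union>(labels C')"
    "parent_label C {u} {v}"
proof -
  show "all_singletons C"
    using assms by induction (auto simp: all_singletons_Node)
  show "{u, v} \<in> labels C'" "\<Union>(labels C) = \<Union>(labels C')"
    using assms by induction auto
  show "parent_label C {u} {v}"
    using assms by induction (simp_all add: parent_label_Node)
qed

lemma not_singleton_Un:
  assumes "A \<inter> B = {}" "A \<noteq> {}" "B \<noteq> {}"
  shows "\<not> is_singleton (A \<union> B)"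
proof -
  obtain a b where "a \<in> A" "b \<in> B" using assms by blast
  moreover from this have "a \<noteq> b" using assms(1) by blast
  ultimately show ?thesis unfolding is_singleton_def by (metis UnCI singletonD)
qed

lemma disjoint_Un_eq_doubleton:
  assumes "A \<union> B = {u, v}" "A \<inter> B = {}" "A \<noteq> {}" "B \<noteq> {}"
  shows "A = {u} \<and> B = {v} \<or> A = {v} \<and> B = {u}"
proof -
  obtain a b where ab: "a \<in> A" "b \<in> B" using assms by blast
  then have "a \<noteq> b" "a \<in> {u, v}" "b \<in> {u, v}" using assms(1,2) by blast+
  then have uv: "{u, v} = {a, b}" "a = u \<and> b = v \<or> a = v \<and> b = u" by auto
  then have "A \<subseteq> {a, b}" "b \<notin> A" "B \<subseteq> {a, b}" "a \<notin> B" using assms(1,2) ab by blast+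
  then have "A = {a}" "B = {b}" using ab by auto
  then show ?thesis using uv(2) by auto
qed

text \<open>The only rule that changes a tree by itself, \<open>contract\<close>, creates the union
  of two disjoint non-empty labels, which is never a singleton.\<close>

lemma construct_le_all_singletons:
  "construct_le HH C C' \<Longrightarrow> all_singletons C' \<Longrightarrow> C = C'"
proof (induction rule: construct_le.induct)
  case (contract HH Y K1 X g Ts1 f Ts)
  have "X \<inter> Y = {}" using comps_without_subset(2)[OF contract(5)] contract(7) by blast
  then have "\<not> is_singleton (Y \<union> X)" using not_singleton_Un[of Y X] contract(3,6) by (simp add: Int_commute)
  then show ?case using contract.prems by (simp add: all_singletons_Node)
qed (auto simp: all_singletons_Node)

lemma construct_le_splits:
  assumes "construct_le HH C C'" "\<forall>L \<in> labels C' - {{u, v}}. is_singleton L" "{u, v} \<in> labels C'" "u \<noteq> v"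
  shows "C = C' \<or> splits u v C C' \<or> splits v u C C'"
  using assms
proof (induction rule: construct_le.induct)
  \<comment> \<open>If the upper step is a genuine split, \<open>C2\<close> has only singleton
    labels and the lower step is trivial; otherwise the lower step carries the whole
    statement.\<close>
  case (trans HH C1 C2 C3)
  have "C2 = C3 \<or> splits u v C2 C3 \<or> splits v u C2 C3"
    using trans.IH(2) trans.prems by blast
  then consider "C2 = C3" | "all_singletons C2" "splits u v C2 C3 \<or> splits v u C2 C3"
    using splits_properties(1)[of u v C2 C3] splits_properties(1)[of v u C2 C3] by metis
  then show ?case
  proof cases
    case 1
    then show ?thesis using trans.IH(1) trans.prems by blast
  next
    case 2
    then show ?thesis using construct_le_all_singletons[OF trans.hyps(1)] by simp
  qed
next
  case (contract HH Y K1 X g Ts1 f Ts)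
  have K1: "K1 \<inter> Y = {}" using comps_without_subset(2)[OF contract(5)] by blast
  then have YX: "Y \<inter> X = {}" using contract(7) by blast
  have "\<not> is_singleton (Y \<union> X)" by (rule not_singleton_Un[OF YX contract(3,6)])
  \<comment> \<open>The merged label is not a singleton, and \<open>{u, v}\<close> is the only label
    allowed to be one.\<close>
  then have eq: "Y \<union> X = {u, v}" using contract.prems(1) by auto
  have Ts: "\<exists>K. K \<inter> (Y \<union> X) = {} \<and> labels_within K t" if t: "t \<in> fset Ts" for t
  proof -
    obtain K where "K \<subseteq> \<Union>HH - Y" "K \<inter> K1 = {}" "labels_within K t"
      using sibling_labels_within[OF contract(5,10,11) t] by blast
    moreover from this have "K \<inter> (Y \<union> X) = {}" using contract(7) by blast
    ultimately show ?thesis by blast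
  qed
  have Ts1: "\<exists>K. K \<inter> (Y \<union> X) = {} \<and> labels_within K t" if t: "t \<in> fset Ts1" for t
  proof -
    have "(K1 - X) \<inter> (Y \<union> X) = {}" using K1 by blast
    then show ?thesis using grandchild_labels_within[OF contract(8,9) t] by blast
  qed
  have singletons: "all_singletons t" if t: "t \<in> fset (Ts1 |\<union>| Ts)" for t
  proof -
    obtain K where "K \<inter> {u, v} = {}" "labels_within K t"
      using t Ts Ts1 unfolding eq by auto
    then have "{u, v} \<notin> labels t" unfolding labels_within_def by blast
    then show ?thesis using contract.prems(1) t unfolding all_singletons_def by auto
  qed
  have "t \<noteq> Node X Ts1" if "K \<inter> (Y \<union> X) = {}" "labels_within K t" for K t
  proof
    assume "t = Node X Ts1"
    then have "X \<subseteq> K" using that(2) by (simp add: labels_within_Node)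
    then show False using that(1) contract(6) by blast
  qed
  then have notin: "Node X Ts1 |\<notin>| Ts" using Ts by metis
  have "Y = {u} \<and> X = {v} \<or> Y = {v} \<and> X = {u}"
    by (rule disjoint_Un_eq_doubleton[OF eq YX contract(3,6)])
  then show ?case
  proof
    assume YX: "Y = {u} \<and> X = {v}"
    have "splits u v (Node {u} (finsert (Node {v} Ts1) Ts)) (Node {u, v} (Ts1 |\<union>| Ts))"
      using notin singletons YX by (intro splits.here) auto
    then show ?thesis unfolding eq using YX by simp
  next
    assume YX: "Y = {v} \<and> X = {u}"
    have "splits v u (Node {v} (finsert (Node {u} Ts1) Ts)) (Node {v, u} (Ts1 |\<union>| Ts))"
      using notin singletons YX by (intro splits.here) auto
    then show ?thesis unfolding eq using YX by (simp add: insert_commute)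
  qed
next
  case (cong HH Y K1 C C' f Ts)
  have C: "labels_within K1 C" "labels_within K1 C'"
    using construct_le_labels[OF cong.hyps(6)] labels_within_mono[OF _ Union_hrestrict_subset] by blast+
  have Ts: "\<exists>K. K \<inter> K1 = {} \<and> labels_within K t" if t: "t \<in> fset Ts" for t
    using sibling_labels_within[OF cong.hyps(5,7,8) t] by blast
  have K1: "K1 \<inter> Y = {}" using comps_without_subset(2)[OF cong.hyps(5)] by blast
  show ?case
  \<comment> \<open>Either the double label lies in the component where the step takes place, which
    forces the root and all siblings to be singletons, or that component has only singleton labels
    and nothing can change there.\<close>
  proof (cases "{u, v} \<in> labels C'")
    case True
    then have "{u, v} \<subseteq> K1" using C(2) unfolding labels_within_def by metis
    then have "\<not> {u, v} \<subseteq> Y" using K1 by blast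
    then have "is_singleton Y" using cong.prems(1) by auto
    then obtain x where "Y = {x}" unfolding is_singleton_def by blast
    have "all_singletons t" if t: "t \<in> fset Ts" for t
    proof -
      obtain K where "K \<inter> K1 = {}" "labels_within K t" using Ts[OF t] by blast
      then have "{u, v} \<notin> labels t" using labels_within_disjoint(1)[OF C(2), of K t] True by blast
      then show ?thesis using cong.prems(1) t unfolding all_singletons_def by auto
    qed
    moreover have "C |\<notin>| Ts"
    proof
      assume "C |\<in>| Ts"
      then obtain K where "K \<inter> K1 = {}" "labels_within K C" using Ts by blast
      then show False using labels_within_disjoint(2)[OF C(1), of K C] by blast
    qed
    moreover have "C = C' \<or> splits u v C C' \<or> splits v u C C'"
      using cong.IH cong.prems True by auto
    ultimately show ?thesis unfolding \<open>Y = {x}\<close> by (auto intro: splits.inside)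
  next
    case False
    then have "all_singletons C'" using cong.prems(1) unfolding all_singletons_def by auto
    then show ?thesis using construct_le_all_singletons[OF cong.hyps(6)] by simp
  qed
qed simp

lemma construct_le_construction_splits:
  assumes "construct_le HH V E" "\<forall>L \<in> labels E - {{u, v}}. is_singleton L" "{u, v} \<in> labels E" "u \<noteq> v"
    and V: "construction HH V" "parent_label V {u} {v}"
  shows "splits u v V E"
proof -
  have "all_singletons V" "construct HH V"
    using V(1) by (simp_all add: construction_def all_singletons_def)
  moreover have "\<not> is_singleton {u, v}" using assms(4) by (auto simp: is_singleton_def doubleton_eq_iff)
  ultimately have "V \<noteq> E" using assms(3) unfolding all_singletons_def by blast
  moreover have "\<not> splits v u V E"
    using construct_parent_label_asym[OF \<open>construct HH V\<close> V(2)] splits_properties(4)[of v u V E] by blast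
  ultimately show ?thesis using construct_le_splits[OF assms(1-4)] by blast
qed

section \<open>The hypergraph of edges\<close>

text \<open>Edge graphs over arbitrary edge sets: after deleting \<open>x\<close> the remaining set
  \<open>edges S - {x}\<close> is in general not the edge set of one tree, and restriction stays
  within this form.\<close>

definition line_graph :: "('a \<times> 'a) set \<Rightarrow> ('a \<times> 'a) set set" where
  "line_graph A = {{e} | e. e \<in> A} \<union> {{e, f} | e f. e \<in> A \<and> f \<in> A \<and> adjacent e f}"

lemma edge_graph_eq_line_graph: "edge_graph T = line_graph (edges T)"
  by (simp add: edge_graph_def line_graph_def)

lemma Union_line_graph [simp]: "\<Union>(line_graph A) = A"
  unfolding line_graph_def by auto

lemma hrestrict_line_graph: "hrestrict (line_graph A) K = line_graph (A \<inter> K)"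
  unfolding line_graph_def hrestrict_def by auto

lemma connected_subset_line_graph:
  "connected_subset (line_graph A) K \<longleftrightarrow>
     K \<noteq> {} \<and> K \<subseteq> A \<and> (\<forall>X. X \<noteq> {} \<and> X \<subset> K \<longrightarrow> (\<exists>e \<in> X. \<exists>f \<in> K - X. adjacent e f))"
proof -
  have crossing: "(\<exists>Z \<in> line_graph A. Z \<subseteq> K \<and> \<not> Z \<subseteq> X \<and> \<not> Z \<subseteq> K - X) \<longleftrightarrow>
      (\<exists>e \<in> X. \<exists>f \<in> K - X. adjacent e f)" if "K \<subseteq> A" "X \<subset> K" for X
  proof
    assume "\<exists>Z \<in> line_graph A. Z \<subseteq> K \<and> \<not> Z \<subseteq> X \<and> \<not> Z \<subseteq> K - X"
    then obtain Z where Z: "Z \<in> line_graph A" "Z \<subseteq> K" "\<not> Z \<subseteq> X" "\<not> Z \<subseteq> K - X" by blast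
    then obtain e f where "Z = {e, f}" "adjacent e f" unfolding line_graph_def by auto
    moreover have "adjacent f e" using \<open>adjacent e f\<close> unfolding adjacent_def by blast
    ultimately show "\<exists>e \<in> X. \<exists>f \<in> K - X. adjacent e f" using Z by auto
  next
    assume "\<exists>e \<in> X. \<exists>f \<in> K - X. adjacent e f"
    then obtain e f where ef: "e \<in> X" "f \<in> K - X" "adjacent e f" by blast
    then have "{e, f} \<in> line_graph A" using that unfolding line_graph_def by blast
    then show "\<exists>Z \<in> line_graph A. Z \<subseteq> K \<and> \<not> Z \<subseteq> X \<and> \<not> Z \<subseteq> K - X"
      using ef that by (intro bexI[of _ "{e, f}"]) auto
  qed
  have "\<Union>(hrestrict (line_graph A) K) = K \<longleftrightarrow> K \<subseteq> A"
    by (auto simp: hrestrict_line_graph)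
  then show ?thesis unfolding connected_subset_iff by (simp only: crossing cong: conj_cong imp_cong)
qed

lemma rooted_tree_connected:
  assumes S: "rooted_tree S" and "edges S \<noteq> {}" "edges S \<subseteq> A"
  shows "connected_subset (line_graph A) (edges S)"
  unfolding connected_subset_line_graph
proof (intro conjI allI impI)
  fix X assume X: "X \<noteq> {} \<and> X \<subset> edges S"
  show "\<exists>e \<in> X. \<exists>f \<in> edges S - X. adjacent e f"
  proof (rule ccontr)
    assume no: "\<not> ?thesis"
    have half: "f \<in> X" if "e \<in> X" "f \<in> edges S" "{fst e, snd e} \<inter> {fst f, snd f} \<noteq> {}" for e f
    proof (rule ccontr)
      assume "f \<notin> X"
      then have "e \<noteq> f" "f \<in> edges S - X" using that by blast+
      then show False using no that unfolding adjacent_def by blast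
    qed
    \<comment> \<open>Without a crossing pair, membership in \<open>X\<close> is the same for any
      two edges that touch. It is propagated along the walk from the root, so that every edge agrees
      with one fixed edge \<open>(root S, a)\<close>.\<close>
    have closed: "e \<in> X \<longleftrightarrow> f \<in> X"
      if "e \<in> edges S" "f \<in> edges S" "{fst e, snd e} \<inter> {fst f, snd f} \<noteq> {}" for e f
      using half that by (metis Int_commute)
    obtain p c where "(p, c) \<in> edges S" using assms(2) by auto
    then have "(root S, p) \<in> (edges S)\<^sup>*"
      using rooted_tree_reach[OF S] rooted_tree_edge_nodes(1)[OF S] by blast
    then obtain a where a: "(root S, a) \<in> edges S"
      using \<open>(p, c) \<in> edges S\<close> by (cases rule: converse_rtranclE) auto
    have root: "(p, c) \<in> X \<longleftrightarrow> (root S, a) \<in> X" if "(p, c) \<in> edges S" for p c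
    proof -
      have "(root S, p) \<in> (edges S)\<^sup>*"
        using rooted_tree_reach[OF S] rooted_tree_edge_nodes(1)[OF S that] by blast
      then show ?thesis using that
      proof (induction arbitrary: c)
        case base
        then show ?case using closed[of "(root S, c)" "(root S, a)"] a by auto
      next
        case (step y z)
        then show ?case using closed[of "(y, z)" "(z, c)"] by auto
      qed
    qed
    then have "e \<in> X \<longleftrightarrow> (root S, a) \<in> X" if "e \<in> edges S" for e using that by (cases e) blast
    then show False using X by blast
  qed
qed (use assms in auto)

text \<open>Any connected set meeting both blocks would contain an adjacent pair across them. Empty
  blocks are allowed, hence the removal of \<open>{}\<close>.\<close>

lemma components_line_graph_Un:
  assumes disj: "A \<inter> B = {}" and far: "\<And>e f. e \<in> A \<Longrightarrow> f \<in> B \<Longrightarrow> \<not> adjacent e f"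
    and conn: "A \<noteq> {} \<Longrightarrow> connected_subset (line_graph (A \<union> B)) A"
      "B \<noteq> {} \<Longrightarrow> connected_subset (line_graph (A \<union> B)) B"
  shows "components (line_graph (A \<union> B)) = {A, B} - {{}}"
proof -
  have sub: "K \<subseteq> A \<or> K \<subseteq> B" if "connected_subset (line_graph (A \<union> B)) K" for K
  proof (rule ccontr)
    assume "\<not> ?thesis"
    moreover have "K \<subseteq> A \<union> B" using that unfolding connected_subset_line_graph by blast
    ultimately have "K \<inter> A \<noteq> {} \<and> K \<inter> A \<subset> K" by blast
    then have "\<exists>e \<in> K \<inter> A. \<exists>f \<in> K - K \<inter> A. adjacent e f"
      using that unfolding connected_subset_line_graph by meson
    then show False using far \<open>K \<subseteq> A \<union> B\<close> by blast
  qed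
  have ne: "K \<noteq> {}" if "connected_subset (line_graph (A \<union> B)) K" for K
    using that unfolding connected_subset_def by blast
  show ?thesis
  proof (intro equalityI subsetI)
    fix K assume K: "K \<in> components (line_graph (A \<union> B))"
    then have c: "connected_subset (line_graph (A \<union> B)) K"
      and max: "\<And>K'. connected_subset (line_graph (A \<union> B)) K' \<Longrightarrow> K \<subseteq> K' \<Longrightarrow> K' = K"
      unfolding components_def by blast+
    from sub[OF c] have "K = A \<or> K = B"
    proof
      assume "K \<subseteq> A"
      then show ?thesis using max[OF conn(1)] ne[OF c] by blast
    next
      assume "K \<subseteq> B"
      then show ?thesis using max[OF conn(2)] ne[OF c] by blast
    qed
    then show "K \<in> {A, B} - {{}}" using ne[OF c] by blast
  next
    fix K assume K: "K \<in> {A, B} - {{}}"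
    have "K' = K" if K': "connected_subset (line_graph (A \<union> B)) K'" "K \<subseteq> K'" for K'
      using sub[OF K'(1)] K K'(2) disj by blast
    moreover have "connected_subset (line_graph (A \<union> B)) K" using K conn by blast
    ultimately show "K \<in> components (line_graph (A \<union> B))" unfolding components_def by blast
  qed
qed

text \<open>Edges from different parts are not adjacent because the parts share no node. A part
  consisting of one node has no edges and yields no component, just as a single letter yields no
  subtree.\<close>

lemma comps_without_edge_graph:
  assumes S: "rooted_tree S" and x: "x \<in> edges S"
  shows "comps_without (edge_graph S) {x} = {edges (upper_part S x), edges (lower_part S x)} - {{}}"
proof -
  let ?U = "edges (upper_part S x)" and ?L = "edges (lower_part S x)"
  have "comps_without (edge_graph S) {x} = components (line_graph (?U \<union> ?L))"
    unfolding parts_edges_cover[OF S x] comps_without_def edge_graph_eq_line_graph hrestrict_line_graph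
    by (simp add: Int_absorb1)
  also have "\<dots> = {?U, ?L} - {{}}"
  proof (rule components_line_graph_Un)
    show "\<not> adjacent e f" if "e \<in> ?U" "f \<in> ?L" for e f
      using parts_edges_nodes(1)[OF S x that(1)] parts_edges_nodes(2)[OF S x that(2)]
        parts_nodes_disjoint[OF S x] unfolding adjacent_def by auto
    show "?U \<noteq> {} \<Longrightarrow> connected_subset (line_graph (?U \<union> ?L)) ?U"
      by (rule rooted_tree_connected[OF rooted_tree_parts(1)[OF S x]]) blast+
    show "?L \<noteq> {} \<Longrightarrow> connected_subset (line_graph (?U \<union> ?L)) ?L"
      by (rule rooted_tree_connected[OF rooted_tree_parts(2)[OF S x]]) blast+
  qed (rule parts_edges_disjoint[OF S x])
  finally show ?thesis .
qed

lemma hrestrict_edge_graph: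
  assumes "edges S' \<subseteq> edges S"
  shows "hrestrict (edge_graph S) (edges S') = edge_graph S'"
  using assms by (simp add: edge_graph_eq_line_graph hrestrict_line_graph Int_absorb1)

section \<open>Words and constructions\<close>

text \<open>Empty for a letter, where \<open>Phi\<close> has no meaningful value, and a one-element
  set otherwise; with it the children of a node are always the union of the contributions of the two
  factors.\<close>

definition Phi_opt :: "'a pword \<Rightarrow> 'a rtree \<Rightarrow> ('a \<times> 'a) set ltree fset" where
  "Phi_opt w S = (case w of Letter a \<Rightarrow> {||} | Juxt w1 w2 \<Rightarrow> {|Phi w S|})"

lemma Phi_opt_Letter [simp]: "Phi_opt (Letter a) S = {||}"
  by (simp add: Phi_opt_def)

lemma Phi_opt_Juxt:
  "Phi_opt (Juxt w1 w2) S = {|Node {grafting_edge S w1 w2}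
     (Phi_opt w1 (upper_part S (grafting_edge S w1 w2)) |\<union>| Phi_opt w2 (lower_part S (grafting_edge S w1 w2)))|}"
  by (simp add: Phi_opt_def Let_def)

primrec first_letter :: "'a pword \<Rightarrow> 'a" where
  "first_letter (Letter a) = a"
| "first_letter (Juxt w1 w2) = first_letter w1"

lemma first_letter_admissible: "admissible w S \<Longrightarrow> first_letter w = root S"
  by (induction w arbitrary: S) auto

text \<open>The right factor of an admissible product begins with the child endpoint of the grafting
  edge, which determines that edge.\<close>

lemma grafting_edge_eq:
  assumes S: "rooted_tree S" and x: "x \<in> edges S" "admissible w1 (upper_part S x)" "admissible w2 (lower_part S x)"
  shows "grafting_edge S w1 w2 = x"
  unfolding grafting_edge_def
proof (rule the_equality)
  fix y assume y: "y \<in> edges S \<and> admissible w1 (upper_part S y) \<and> admissible w2 (lower_part S y)"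
  then have "snd y = first_letter w2" using first_letter_admissible[of w2 "lower_part S y"] by simp
  also have "\<dots> = snd x" using first_letter_admissible[OF x(3)] by simp
  finally have "snd y = snd x" .
  moreover from this have "fst y = fst x"
    using rooted_tree_parent_unique[OF S, of "fst y" "snd x" "fst x"] x(1) y
    by (metis prod.collapse)
  ultimately show "y = x" by (simp add: prod_eq_iff)
qed (use x in simp)

lemma admissible_JuxtE:
  assumes "rooted_tree S" "admissible (Juxt w1 w2) S"
  obtains x where "x \<in> edges S" "admissible w1 (upper_part S x)" "admissible w2 (lower_part S x)"
    "Phi_opt (Juxt w1 w2) S = {|Node {x} (Phi_opt w1 (upper_part S x) |\<union>| Phi_opt w2 (lower_part S x))|}"
proof -
  obtain x where x: "x \<in> edges S" "admissible w1 (upper_part S x)" "admissible w2 (lower_part S x)"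
    using assms(2) by auto
  show thesis
    using that[OF x] Phi_opt_Juxt[of w1 w2 S] grafting_edge_eq[OF assms(1) x] by simp
qed

lemma admissible_edges_empty_iff:
  assumes "admissible w S"
  shows "edges S = {} \<longleftrightarrow> (\<exists>a. w = Letter a)"
  using assms by (cases w) auto

lemma Phi_opt_cases:
  assumes "rooted_tree S" "admissible w S"
  obtains "edges S = {}" "w = Letter (root S)" "Phi_opt w S = {||}"
  | w1 w2 x where "w = Juxt w1 w2" "x \<in> edges S" "admissible w1 (upper_part S x)" "admissible w2 (lower_part S x)"
    "Phi_opt w S = {|Node {x} (Phi_opt w1 (upper_part S x) |\<union>| Phi_opt w2 (lower_part S x))|}"
proof (cases w)
  case (Letter a)
  then have "S = \<lparr>nodes = {a}, root = a, edges = {}\<rparr>" using assms(2) by simp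
  then show thesis using Letter by (intro that(1)) simp_all
next
  case (Juxt w1 w2)
  then obtain x where "x \<in> edges S" "admissible w1 (upper_part S x)" "admissible w2 (lower_part S x)"
    "Phi_opt w S = {|Node {x} (Phi_opt w1 (upper_part S x) |\<union>| Phi_opt w2 (lower_part S x))|}"
    using admissible_JuxtE[OF assms(1)] assms(2) by metis
  then show thesis by (rule that(2)[OF Juxt])
qed

text \<open>The invariant by which a subtree of a construction is assigned to the part of the tree
  it encodes.\<close>

lemma Union_labels_Phi_opt:
  assumes "rooted_tree S" "admissible w S"
  shows "\<Union>(\<Union>t \<in> fset (Phi_opt w S). labels t) = edges S"
  using assms
proof (induction w arbitrary: S)
  case (Letter a)
  then show ?case by simp
next
  case (Juxt w1 w2)
  obtain x where x: "x \<in> edges S" "admissible w1 (upper_part S x)" "admissible w2 (lower_part S x)"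
    and phi: "Phi_opt (Juxt w1 w2) S = {|Node {x} (Phi_opt w1 (upper_part S x) |\<union>| Phi_opt w2 (lower_part S x))|}"
    by (rule admissible_JuxtE[OF Juxt.prems])
  have "\<Union>(\<Union>t \<in> fset (Phi_opt (Juxt w1 w2) S). labels t) =
      insert x (\<Union>(\<Union>t \<in> fset (Phi_opt w1 (upper_part S x)). labels t) \<union>
        \<Union>(\<Union>t \<in> fset (Phi_opt w2 (lower_part S x)). labels t))"
    unfolding phi by auto
  also have "\<dots> = insert x (edges (upper_part S x) \<union> edges (lower_part S x))"
    using Juxt.IH(1)[OF rooted_tree_parts(1)] Juxt.IH(2)[OF rooted_tree_parts(2)] Juxt.prems(1) x by simp
  also have "\<dots> = edges S" using parts_edges_cover[OF Juxt.prems(1) x(1)] x(1) by auto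
  finally show ?case .
qed

lemma Phi_opt_member:
  assumes "rooted_tree S" "admissible w S" "t |\<in>| Phi_opt w S"
  shows "Phi_opt w S = {|t|}" "\<Union>(labels t) = edges S" "edges S \<noteq> {}"
proof -
  show t: "Phi_opt w S = {|t|}" "edges S \<noteq> {}"
    using assms(3) by (cases rule: Phi_opt_cases[OF assms(1,2)]; auto)+
  show "\<Union>(labels t) = edges S"
    using Union_labels_Phi_opt[OF assms(1,2)] unfolding t by simp
qed

lemma Phi_opt_notin:
  assumes "rooted_tree S" "admissible w S" "\<Union>(labels t) \<inter> edges S = {}"
  shows "t |\<notin>| Phi_opt w S"
  using Phi_opt_member[OF assms(1,2)] assms(3) by auto

lemma Phi_opt_away:
  assumes "rooted_tree S" "admissible w S" "edges S \<inter> A = {}" "t |\<in>| Phi_opt w S"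
  shows "\<Union>(labels t) \<inter> A = {}"
  using Phi_opt_member(2)[OF assms(1,2,4)] assms(3) by simp

text \<open>Cancellation: a tree encoding a word for \<open>S\<close> has exactly the edges of
  \<open>S\<close>, a non-empty set, in its labels, so it cannot be one of the trees in
  \<open>X\<close> or \<open>X'\<close>.\<close>

lemma Phi_opt_eqI:
  assumes S: "rooted_tree S" and w: "admissible w S" "admissible w' S"
    and eq: "Phi_opt w S |\<union>| X = Phi_opt w' S |\<union>| X'"
    and away: "\<And>t. t |\<in>| X |\<union>| X' \<Longrightarrow> \<Union>(labels t) \<inter> edges S = {}"
  shows "Phi_opt w S = Phi_opt w' S"
proof -
  have "t |\<in>| Phi_opt b S"
    if "Phi_opt a S |\<union>| Y = Phi_opt b S |\<union>| Y'" "admissible a S" "t |\<in>| Phi_opt a S" "Y' |\<subseteq>| X |\<union>| X'" for a b Y Y' t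
  proof (rule ccontr)
    assume "t |\<notin>| Phi_opt b S"
    then have "t |\<in>| Y'" using that(1,3) by (metis funion_iff)
    then have "\<Union>(labels t) \<inter> edges S = {}" using away that(4) by blast
    then show False using Phi_opt_notin[OF S that(2)] that(3) by blast
  qed
  from this[of w X w' X'] this[of w' X' w X] show ?thesis
    using eq w by (intro fset_eqI iffI) auto
qed

text \<open>The root label reveals the grafting edge; the union of the children then separates into
  the contributions of the two parts.\<close>

lemma Phi_opt_inj:
  assumes "rooted_tree S" "admissible w S" "admissible w' S" "Phi_opt w S = Phi_opt w' S"
  shows "w = w'"
  using assms
proof (induction w arbitrary: w' S)
  case (Letter a)
  from \<open>admissible w' S\<close> show ?case
    by (cases rule: Phi_opt_cases[OF Letter.prems(1,3)]) (use Letter.prems(2,4) in auto)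
next
  case (Juxt w1 w2)
  obtain x where x: "x \<in> edges S" "admissible w1 (upper_part S x)" "admissible w2 (lower_part S x)"
    and phi: "Phi_opt (Juxt w1 w2) S = {|Node {x} (Phi_opt w1 (upper_part S x) |\<union>| Phi_opt w2 (lower_part S x))|}"
    by (rule admissible_JuxtE[OF Juxt.prems(1,2)])
  obtain w1' w2' where w': "w' = Juxt w1' w2'"
    using Juxt.prems(4) phi by (cases w') auto
  obtain y where y: "y \<in> edges S" "admissible w1' (upper_part S y)" "admissible w2' (lower_part S y)"
    and phi': "Phi_opt (Juxt w1' w2') S = {|Node {y} (Phi_opt w1' (upper_part S y) |\<union>| Phi_opt w2' (lower_part S y))|}"
    by (rule admissible_JuxtE[OF Juxt.prems(1)]) (use Juxt.prems(3) w' in auto)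
  note S = rooted_tree_parts[OF Juxt.prems(1) x(1)]
  have yx: "y = x"
    using Juxt.prems(4) unfolding w' phi phi' by simp
  note y = y[unfolded yx]
  have eq: "Phi_opt w1 (upper_part S x) |\<union>| Phi_opt w2 (lower_part S x) =
      Phi_opt w1' (upper_part S x) |\<union>| Phi_opt w2' (lower_part S x)"
    using Juxt.prems(4) unfolding w' phi phi' yx by simp
  have disj: "edges (upper_part S x) \<inter> edges (lower_part S x) = {}"
    by (rule parts_edges_disjoint[OF Juxt.prems(1) x(1)])
  have "Phi_opt w1 (upper_part S x) = Phi_opt w1' (upper_part S x)"
  proof (rule Phi_opt_eqI[OF S(1) x(2) y(2) eq])
    fix t assume "t |\<in>| Phi_opt w2 (lower_part S x) |\<union>| Phi_opt w2' (lower_part S x)"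
    then show "\<Union>(labels t) \<inter> edges (upper_part S x) = {}"
      using Phi_opt_away[OF S(2) x(3)] Phi_opt_away[OF S(2) y(3)] disj by (metis Int_commute funion_iff)
  qed
  moreover have "Phi_opt w2 (lower_part S x) = Phi_opt w2' (lower_part S x)"
  proof (rule Phi_opt_eqI[OF S(2) x(3) y(3)])
    show "Phi_opt w2 (lower_part S x) |\<union>| Phi_opt w1 (upper_part S x) =
        Phi_opt w2' (lower_part S x) |\<union>| Phi_opt w1' (upper_part S x)"
      using eq by (simp only: funion_commute)
    fix t assume "t |\<in>| Phi_opt w1 (upper_part S x) |\<union>| Phi_opt w1' (upper_part S x)"
    then show "\<Union>(labels t) \<inter> edges (lower_part S x) = {}"
      using Phi_opt_away[OF S(1) x(2) disj] Phi_opt_away[OF S(1) y(2) disj] by blast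
  qed
  ultimately show ?case
    using Juxt.IH(1)[OF S(1) x(2) y(2)] Juxt.IH(2)[OF S(2) x(3) y(3)] w' by simp
qed

lemma Phi_opt_surj:
  assumes "construct HH V" "HH = edge_graph S" "rooted_tree S" "edges S \<noteq> {}" "all_singletons V"
  shows "\<exists>w. admissible w S \<and> Phi_opt w S = {|V|}"
  using assms
proof (induction arbitrary: S rule: construct_induct)
  case (construct HH Y f Ts)
  have "is_singleton Y" using construct.prems(4) by (simp add: all_singletons_Node)
  then obtain x where Y: "Y = {x}" unfolding is_singleton_def by blast
  have x: "x \<in> edges S"
    using construct.hyps(2) unfolding Y construct.prems(1) by (simp add: edge_graph_eq_line_graph)
  have comps: "comps_without HH Y = {edges (upper_part S x), edges (lower_part S x)} - {{}}"
    unfolding construct.prems(1) Y by (rule comps_without_edge_graph[OF construct.prems(2) x])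
  \<comment> \<open>Uniform treatment of the upper and the lower part: without edges the word is a
    single letter and contributes no child; otherwise the edge set is a component and the induction
    hypothesis supplies the word.\<close>
  have part: "\<exists>w. admissible w P \<and> fset (Phi_opt w P) = f ` ({edges P} - {{}})"
    if P: "rooted_tree P" "edges P \<subseteq> edges S" "edges P \<noteq> {} \<Longrightarrow> edges P \<in> comps_without HH Y" for P
  proof (cases "edges P = {}")
    case True
    then have "admissible (Letter (root P)) P" using rooted_tree_no_edges[OF P(1)] by simp
    then show ?thesis using True by (intro exI[of _ "Letter (root P)"]) simp
  next
    case False
    then have K: "edges P \<in> comps_without HH Y" by (rule P(3))
    have "f (edges P) |\<in>| Ts" using K construct.hyps(4) by simp
    then have "all_singletons (f (edges P))" using construct.prems(4) by (simp add: all_singletons_Node)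
    moreover have "hrestrict HH (edges P) = edge_graph P"
      unfolding construct.prems(1) by (rule hrestrict_edge_graph[OF P(2)])
    ultimately obtain w where "admissible w P" "Phi_opt w P = {|f (edges P)|}"
      using construct.IH[OF K _ P(1) False] by blast
    then show ?thesis using False by auto
  qed
  have sub: "edges (upper_part S x) \<subseteq> edges S" "edges (lower_part S x) \<subseteq> edges S"
    using parts_edges_cover[OF construct.prems(2) x] by blast+
  obtain w1 where w1: "admissible w1 (upper_part S x)"
      "fset (Phi_opt w1 (upper_part S x)) = f ` ({edges (upper_part S x)} - {{}})"
    using part[OF rooted_tree_parts(1)[OF construct.prems(2) x] sub(1)] unfolding comps by blast
  obtain w2 where w2: "admissible w2 (lower_part S x)"
      "fset (Phi_opt w2 (lower_part S x)) = f ` ({edges (lower_part S x)} - {{}})"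
    using part[OF rooted_tree_parts(2)[OF construct.prems(2) x] sub(2)] unfolding comps by blast
  have "fset Ts = fset (Phi_opt w1 (upper_part S x) |\<union>| Phi_opt w2 (lower_part S x))"
    unfolding construct.hyps(4) comps union_fset w1(2) w2(2) by blast
  then have Ts: "Ts = Phi_opt w1 (upper_part S x) |\<union>| Phi_opt w2 (lower_part S x)"
    by (simp only: fset_inject)
  have "Phi_opt (Juxt w1 w2) S = {|Node Y Ts|}"
    unfolding Phi_opt_Juxt grafting_edge_eq[OF construct.prems(2) x w1(1) w2(1)] Y Ts ..
  moreover have "admissible (Juxt w1 w2) S" using x w1(1) w2(1) by auto
  ultimately show ?case by blast
qed

lemma Phi_inv_construction:
  assumes "rooted_tree T" "edges T \<noteq> {}" "construction (edge_graph T) V"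
  shows "admissible (Phi_inv T V) T" "Phi_opt (Phi_inv T V) T = {|V|}"
proof -
  have "construct (edge_graph T) V" "all_singletons V"
    using assms(3) by (simp_all add: construction_def all_singletons_def)
  then obtain w where w: "admissible w T" "Phi_opt w T = {|V|}"
    using Phi_opt_surj[OF _ HOL.refl assms(1,2)] by blast
  have Phi_opt_eq: "Phi_opt w T = {|Phi w T|}" if "admissible w T" for w
    using admissible_edges_empty_iff[OF that] assms(2) by (cases w) (simp_all add: Phi_opt_def)
  \<comment> \<open>\<open>inv_into\<close> is meaningful only on the image. Since \<open>T\<close>
    has an edge, no admissible word is a letter, so \<open>Phi\<close> is defined on all of
    them.\<close>
  have V: "V \<in> (\<lambda>w. Phi w T) ` {w. admissible w T}" using w Phi_opt_eq[OF w(1)] by auto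
  show adm: "admissible (Phi_inv T V) T"
    using inv_into_into[OF V] by (simp add: Phi_inv_def)
  show "Phi_opt (Phi_inv T V) T = {|V|}"
    using f_inv_into_f[OF V] Phi_opt_eq[OF adm] by (simp add: Phi_inv_def)
qed

section \<open>Words over a tree cut into three parts\<close>

lemma Phi_opt_Un_inj:
  assumes "rooted_tree S" "admissible w S" "admissible w' S" "Phi_opt w S |\<union>| X = Phi_opt w' S |\<union>| X'"
    and "\<And>t. t |\<in>| X |\<union>| X' \<Longrightarrow> \<Union>(labels t) \<inter> edges S = {}"
  shows "w = w'"
  using Phi_opt_inj[OF assms(1-3) Phi_opt_eqI[OF assms]] .

lemma funion_rotate:
  "A |\<union>| (B |\<union>| C) = B |\<union>| A |\<union>| C" "A |\<union>| (B |\<union>| C) = B |\<union>| C |\<union>| A"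
  by auto

lemma Phi_opt_Un3_inj:
  assumes P: "rooted_tree P1" "rooted_tree P2" "rooted_tree P3"
    and disj: "edges P1 \<inter> edges P2 = {}" "edges P1 \<inter> edges P3 = {}" "edges P2 \<inter> edges P3 = {}"
    and adm: "admissible s1 P1" "admissible s2 P2" "admissible s3 P3"
    and adm': "admissible t1 P1" "admissible t2 P2" "admissible t3 P3"
    and eq: "Phi_opt s1 P1 |\<union>| Phi_opt s2 P2 |\<union>| Phi_opt s3 P3 = Phi_opt t1 P1 |\<union>| Phi_opt t2 P2 |\<union>| Phi_opt t3 P3"
  shows "s1 = t1" "s2 = t2" "s3 = t3"
proof -
  have away: "\<Union>(labels t) \<inter> A = {}"
    if "rooted_tree Q" "rooted_tree R" "admissible a Q" "admissible b R" "admissible c Q" "admissible d R"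
      "edges Q \<inter> A = {}" "edges R \<inter> A = {}"
      "t |\<in>| Phi_opt a Q |\<union>| Phi_opt b R |\<union>| (Phi_opt c Q |\<union>| Phi_opt d R)" for Q R a b c d A t
    using that(9) Phi_opt_away[OF that(1,3,7)] Phi_opt_away[OF that(1,5,7)]
      Phi_opt_away[OF that(2,4,8)] Phi_opt_away[OF that(2,6,8)] by (metis funion_iff)
  have disj': "edges P2 \<inter> edges P1 = {}" "edges P3 \<inter> edges P1 = {}" "edges P3 \<inter> edges P2 = {}"
    using disj by blast+
  have eq1: "Phi_opt s1 P1 |\<union>| (Phi_opt s2 P2 |\<union>| Phi_opt s3 P3) =
      Phi_opt t1 P1 |\<union>| (Phi_opt t2 P2 |\<union>| Phi_opt t3 P3)"
    using eq by (simp only: funion_assoc)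
  have eq2: "Phi_opt s2 P2 |\<union>| (Phi_opt s1 P1 |\<union>| Phi_opt s3 P3) =
      Phi_opt t2 P2 |\<union>| (Phi_opt t1 P1 |\<union>| Phi_opt t3 P3)"
    using eq by (simp only: funion_rotate(1))
  have eq3: "Phi_opt s3 P3 |\<union>| (Phi_opt s1 P1 |\<union>| Phi_opt s2 P2) =
      Phi_opt t3 P3 |\<union>| (Phi_opt t1 P1 |\<union>| Phi_opt t2 P2)"
    using eq by (simp only: funion_rotate(2))
  show "s1 = t1"
    by (rule Phi_opt_Un_inj[OF P(1) adm(1) adm'(1) eq1 away[OF P(2,3) adm(2,3) adm'(2,3) disj'(1,2)]])
  show "s2 = t2"
    by (rule Phi_opt_Un_inj[OF P(2) adm(2) adm'(2) eq2 away[OF P(1,3) adm(1,3) adm'(1,3) disj(1) disj'(3)]])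
  show "s3 = t3"
    by (rule Phi_opt_Un_inj[OF P(3) adm(3) adm'(3) eq3 away[OF P(1,2) adm(1,2) adm'(1,2) disj(2,3)]])
qed

lemma Phi_opt_NodeE:
  assumes "rooted_tree S" "admissible w S" "Node X Ts |\<in>| Phi_opt w S"
  obtains w1 w2 x where "w = Juxt w1 w2" "x \<in> edges S" "X = {x}"
    "admissible w1 (upper_part S x)" "admissible w2 (lower_part S x)"
    "Ts = Phi_opt w1 (upper_part S x) |\<union>| Phi_opt w2 (lower_part S x)"
  by (cases rule: Phi_opt_cases[OF assms(1,2)]) (use assms(3) that in auto)

lemma finsert_eq_funionD:
  assumes "finsert t Ts = A |\<union>| B" "t |\<notin>| Ts" "A = {|t|}" "t |\<notin>| B"
  shows "Ts = B"
  using assms by (metis finsert_ident finsert_is_funion)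

text \<open>The child labelled \<open>{v}\<close> may encode either factor; its labels decide which,
  and this gives the two bracketings. Because it does not occur in \<open>Ts2\<close>, removing it
  leaves exactly the contribution of the other factor.\<close>

lemma Phi_opt_two_nodes:
  assumes S: "rooted_tree S" and w: "admissible w S"
    and phi: "Phi_opt w S = {|Node {u} (finsert (Node {v} Ts1) Ts2)|}" and notin: "Node {v} Ts1 |\<notin>| Ts2"
  obtains (lower) s1 s2 s3 where "u \<in> edges S" "v \<in> edges (lower_part S u)" "w = Juxt s1 (Juxt s2 s3)"
      "admissible s1 (upper_part S u)" "admissible s2 (upper_part (lower_part S u) v)"
      "admissible s3 (lower_part (lower_part S u) v)"
      "Ts1 |\<union>| Ts2 = Phi_opt s1 (upper_part S u) |\<union>| Phi_opt s2 (upper_part (lower_part S u) v) |\<union>|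
        Phi_opt s3 (lower_part (lower_part S u) v)"
  | (upper) s1 s2 s3 where "u \<in> edges S" "v \<in> edges (upper_part S u)" "w = Juxt (Juxt s1 s2) s3"
      "admissible s1 (upper_part (upper_part S u) v)" "admissible s2 (lower_part (upper_part S u) v)"
      "admissible s3 (lower_part S u)"
      "Ts1 |\<union>| Ts2 = Phi_opt s1 (upper_part (upper_part S u) v) |\<union>|
        Phi_opt s2 (lower_part (upper_part S u) v) |\<union>| Phi_opt s3 (lower_part S u)"
proof -
  obtain w1 w2 where w12: "w = Juxt w1 w2" and u: "u \<in> edges S"
    and adm: "admissible w1 (upper_part S u)" "admissible w2 (lower_part S u)"
    and children: "finsert (Node {v} Ts1) Ts2 = Phi_opt w1 (upper_part S u) |\<union>| Phi_opt w2 (lower_part S u)"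
    by (rule Phi_opt_NodeE[OF S w, of "{u}" "finsert (Node {v} Ts1) Ts2"]) (use phi in auto)
  note parts = rooted_tree_parts[OF S u]
  have disj: "edges (upper_part S u) \<inter> edges (lower_part S u) = {}" by (rule parts_edges_disjoint[OF S u])
  have "Node {v} Ts1 |\<in>| Phi_opt w1 (upper_part S u) |\<union>| Phi_opt w2 (lower_part S u)"
    unfolding children[symmetric] by simp
  then consider (l) "Node {v} Ts1 |\<in>| Phi_opt w2 (lower_part S u)" | (u) "Node {v} Ts1 |\<in>| Phi_opt w1 (upper_part S u)"
    by auto
  then show thesis
  proof cases
    case l
    have "Node {v} Ts1 |\<notin>| Phi_opt w1 (upper_part S u)"
      by (rule Phi_opt_notin[OF parts(1) adm(1)]) (use Phi_opt_member(2)[OF parts(2) adm(2) l] disj in auto)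
    then have Ts2: "Ts2 = Phi_opt w1 (upper_part S u)"
      using finsert_eq_funionD[OF _ notin Phi_opt_member(1)[OF parts(2) adm(2) l]] children
      by (metis funion_commute)
    obtain s2 s3 where "w2 = Juxt s2 s3" "v \<in> edges (lower_part S u)"
      "admissible s2 (upper_part (lower_part S u) v)" "admissible s3 (lower_part (lower_part S u) v)"
      "Ts1 = Phi_opt s2 (upper_part (lower_part S u) v) |\<union>| Phi_opt s3 (lower_part (lower_part S u) v)"
      by (rule Phi_opt_NodeE[OF parts(2) adm(2) l]) auto
    then show ?thesis
      using u w12 adm Ts2 by (intro lower[of w1 s2 s3]) (simp_all only: funion_assoc funion_commute funion_left_commute)
  next
    case u
    have "Node {v} Ts1 |\<notin>| Phi_opt w2 (lower_part S u)"
      by (rule Phi_opt_notin[OF parts(2) adm(2)]) (use Phi_opt_member(2)[OF parts(1) adm(1) u] disj in auto)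
    then have Ts2: "Ts2 = Phi_opt w2 (lower_part S u)"
      by (rule finsert_eq_funionD[OF children notin Phi_opt_member(1)[OF parts(1) adm(1) u]])
    obtain s1 s2 where "w1 = Juxt s1 s2" "v \<in> edges (upper_part S u)"
      "admissible s1 (upper_part (upper_part S u) v)" "admissible s2 (lower_part (upper_part S u) v)"
      "Ts1 = Phi_opt s1 (upper_part (upper_part S u) v) |\<union>| Phi_opt s2 (lower_part (upper_part S u) v)"
      by (rule Phi_opt_NodeE[OF parts(1) adm(1) u]) auto
    then show ?thesis
      using \<open>u \<in> edges S\<close> w12 adm Ts2 by (intro upper[of s1 s2 w2]) simp_all
  qed
qed

text \<open>By \<open>parts_nested\<close> the words \<open>s1\<close>, \<open>s2\<close>,
  \<open>s3\<close> belong to the same trees as \<open>t1\<close>, \<open>t2\<close>,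
  \<open>t3\<close>, in this order, so they agree after cancellation.\<close>

lemma nested_splits_assoc:
  assumes S: "rooted_tree S" and uv: "u \<in> edges S" "v \<in> edges (lower_part S u)"
    and s: "admissible s1 (upper_part S u)" "admissible s2 (upper_part (lower_part S u) v)"
      "admissible s3 (lower_part (lower_part S u) v)"
    and t: "admissible t1 (upper_part (upper_part S v) u)" "admissible t2 (lower_part (upper_part S v) u)"
      "admissible t3 (lower_part S v)"
    and eq: "Phi_opt s1 (upper_part S u) |\<union>| Phi_opt s2 (upper_part (lower_part S u) v) |\<union>|
        Phi_opt s3 (lower_part (lower_part S u) v) =
      Phi_opt t1 (upper_part (upper_part S v) u) |\<union>| Phi_opt t2 (lower_part (upper_part S v) u) |\<union>|
        Phi_opt t3 (lower_part S v)"
  shows "assoc_rule (Juxt (Juxt t1 t2) t3) (Juxt s1 (Juxt s2 s3))"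
proof -
  note nested = parts_nested[OF S uv]
  note low = rooted_tree_parts(2)[OF S uv(1)]
  have disj: "edges (upper_part S u) \<inter> edges (lower_part S u) = {}"
    "edges (upper_part (lower_part S u) v) \<inter> edges (lower_part (lower_part S u) v) = {}"
    by (rule parts_edges_disjoint[OF S uv(1)] parts_edges_disjoint[OF low uv(2)])+
  have sub: "edges (upper_part (lower_part S u) v) \<subseteq> edges (lower_part S u)"
    "edges (lower_part (lower_part S u) v) \<subseteq> edges (lower_part S u)"
    using parts_edges_cover[OF low uv(2)] by blast+
  note roots = rooted_tree_parts(1)[OF S uv(1)] rooted_tree_parts[OF low uv(2)]
  have "s1 = t1 \<and> s2 = t2 \<and> s3 = t3"
    using Phi_opt_Un3_inj[OF roots _ _ disj(2) s, of t1 t2 t3] t eq disj(1) sub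
    unfolding nested(2-3) nested(4)[symmetric] by blast
  then show ?thesis by (simp add: assoc_rule.intros)
qed

text \<open>The outermost factor is the one cut off first. Cutting in the opposite order therefore
  interchanges the last two: \<open>s2\<close> and \<open>t3\<close> belong to the lower part at
  \<open>v\<close>, \<open>s3\<close> and \<open>t2\<close> to that at \<open>u\<close>.\<close>

lemma independent_splits_exchange:
  assumes S: "rooted_tree S" and uv: "u \<in> edges (upper_part S v)" "v \<in> edges (upper_part S u)"
    and s: "admissible s1 (upper_part (upper_part S u) v)" "admissible s2 (lower_part (upper_part S u) v)"
      "admissible s3 (lower_part S u)"
    and t: "admissible t1 (upper_part (upper_part S v) u)" "admissible t2 (lower_part (upper_part S v) u)"
      "admissible t3 (lower_part S v)"
    and eq: "Phi_opt s1 (upper_part (upper_part S u) v) |\<union>| Phi_opt s2 (lower_part (upper_part S u) v) |\<union>|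
        Phi_opt s3 (lower_part S u) =
      Phi_opt t1 (upper_part (upper_part S v) u) |\<union>| Phi_opt t2 (lower_part (upper_part S v) u) |\<union>|
        Phi_opt t3 (lower_part S v)"
  shows "exchange_rule (Juxt (Juxt s1 s2) s3) (Juxt (Juxt t1 t2) t3)"
proof -
  have u: "u \<in> edges S" using uv(1) by (simp add: edges_upper_part)
  note ind = parts_independent[OF S uv] parts_independent(2)[OF S uv(2,1)]
  note up = rooted_tree_parts(1)[OF S u]
  have disj: "edges (upper_part S u) \<inter> edges (lower_part S u) = {}"
    "edges (upper_part (upper_part S u) v) \<inter> edges (lower_part (upper_part S u) v) = {}"
    by (rule parts_edges_disjoint[OF S u] parts_edges_disjoint[OF up uv(2)])+
  have sub: "edges (upper_part (upper_part S u) v) \<subseteq> edges (upper_part S u)"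
    "edges (lower_part (upper_part S u) v) \<subseteq> edges (upper_part S u)"
    using parts_edges_cover[OF up uv(2)] by blast+
  note roots = rooted_tree_parts[OF up uv(2)] rooted_tree_parts(2)[OF S u]
  have t': "admissible t1 (upper_part (upper_part S u) v)" "admissible t3 (lower_part (upper_part S u) v)"
    "admissible t2 (lower_part S u)"
    using t ind by simp_all
  have eq': "Phi_opt s1 (upper_part (upper_part S u) v) |\<union>| Phi_opt s2 (lower_part (upper_part S u) v) |\<union>|
        Phi_opt s3 (lower_part S u) =
      Phi_opt t1 (upper_part (upper_part S u) v) |\<union>| Phi_opt t3 (lower_part (upper_part S u) v) |\<union>|
        Phi_opt t2 (lower_part S u)"
    unfolding eq unfolding ind by auto
  have disj': "edges (upper_part (upper_part S u) v) \<inter> edges (lower_part S u) = {}"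
    "edges (lower_part (upper_part S u) v) \<inter> edges (lower_part S u) = {}"
    using disj(1) sub by blast+
  have "s1 = t1" "s2 = t3" "s3 = t2"
    by (rule Phi_opt_Un3_inj[OF roots disj(2) disj' s t' eq'])+
  then show ?thesis by (simp add: exchange_rule.intros)
qed

text \<open>Here \<open>w\<close> is the word in which \<open>u\<close> is grafted above
  \<open>v\<close>. If \<open>v\<close> lies below \<open>u\<close>, then \<open>w\<close> has the
  form \<open>s1(s2 s3)\<close> at the relevant place, so the rule leads from \<open>w'\<close> to
  \<open>w\<close>. Every clause is stable under enlarging the tree.\<close>

definition rotation :: "'a rtree \<Rightarrow> 'a \<times> 'a \<Rightarrow> 'a \<times> 'a \<Rightarrow> 'a pword \<Rightarrow> 'a pword \<Rightarrow> bool" where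
  "rotation S u v w w' \<longleftrightarrow> below S u v \<and> replace_one assoc_rule w' w \<or>
     below S v u \<and> replace_one assoc_rule w w' \<or>
     diverge S (snd u) (snd v) \<and> replace_one exchange_rule w w'"

lemma rotation_mono:
  assumes "rotation S u v w w'" "edges S \<subseteq> edges S'"
  shows "rotation S' u v (Juxt w s) (Juxt w' s)" "rotation S' u v (Juxt s w) (Juxt s w')"
  using assms below_mono[OF assms(2)] diverge_mono[OF assms(2)] unfolding rotation_def
  by (blast intro: replace_one.left replace_one.right)+

text \<open>Both splits go through the same child, since \<open>C'\<close> is the only child
  carrying a label that is not a singleton.\<close>

lemma splits_insideE:
  assumes C: "splits u v C C'" and D: "splits v u D (Node {x} (finsert C' Ts))"
    and Ts: "\<forall>t \<in> fset Ts. all_singletons t" and "u \<noteq> v"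
  obtains D' where "splits v u D' C'" "D' |\<notin>| Ts" "D = Node {x} (finsert D' Ts)"
  using D
proof cases
  case (here Ts1 Ts2)
  then have "{v, u} = {x}" by simp
  then show ?thesis using \<open>u \<noteq> v\<close> by (simp add: doubleton_eq_iff insert_absorb2 set_eq_iff) metis
next
  case (inside D' D'' Ts' x')
  have not_all: "\<not> all_singletons t" if "{u, v} \<in> labels t" for t
    using that \<open>u \<noteq> v\<close> unfolding all_singletons_def is_singleton_def
    by (metis insertI1 insert_commute singletonD)
  have "\<not> all_singletons C'" "\<not> all_singletons D''"
    using not_all[OF splits_properties(2)[OF C]] not_all[of D''] splits_properties(2)[OF inside(4)]
    by (simp_all add: insert_commute)
  then have notin: "C' |\<notin>| Ts" "C' |\<notin>| Ts'" "D'' |\<notin>| Ts" "D'' |\<notin>| Ts'"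
    using Ts inside(6) by metis+
  have eq: "finsert C' Ts = finsert D'' Ts'" by (rule inside(3))
  then have "D'' = C'" using notin by (metis finsertE finsertI1)
  moreover from this have "Ts' = Ts" using eq notin by (metis finsert_ident)
  ultimately show ?thesis using that[of D'] inside by simp
qed

text \<open>Both constructions are followed simultaneously down \<open>E\<close>, with
  \<open>S\<close> shrinking to the part that contains the double node, until that node is the
  root.\<close>

lemma splits_rotation:
  assumes "splits u v C E" "splits v u D E" "u \<noteq> v" "rooted_tree S"
    and "admissible w S" "Phi_opt w S = {|C|}" "admissible w' S" "Phi_opt w' S = {|D|}"
  shows "rotation S u v w w'"
  using assms
proof (induction arbitrary: D S w w' rule: splits.induct)
  case (here Ts1 Ts2)
  note S = \<open>rooted_tree S\<close>
  from \<open>splits v u D _\<close> obtain Ts1' Ts2' where D: "Node {u} Ts1' |\<notin>| Ts2'"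
      "D = Node {v} (finsert (Node {u} Ts1') Ts2')" "Ts1 |\<union>| Ts2 = Ts1' |\<union>| Ts2'"
  proof cases
    case (here Ts1' Ts2')
    then show ?thesis using that by simp
  next
    case (inside D' D'' Ts' x)
    then have "{u, v} = {x}" by simp
    then show ?thesis using \<open>u \<noteq> v\<close> by (metis insertI1 insert_commute singletonD)
  qed
  show ?case
  proof (cases rule: Phi_opt_two_nodes[OF S \<open>admissible w S\<close> \<open>Phi_opt w S = _\<close> here.hyps(1)])
    case (1 s1 s2 s3)
    note s = 1
    have below: "below S u v"
      using below_iff_lower_part[OF S s(1), of v] s(2) by (auto simp: edges_lower_part)
    show ?thesis
    proof (cases rule: Phi_opt_two_nodes[OF S \<open>admissible w' S\<close> \<open>Phi_opt w' S = _\<close>[unfolded D(2)] D(1)])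
      case (1 t1 t2 t3)
      \<comment> \<open>Both edges would lie below each other, which their levels exclude.\<close>
      then have "below S v u" using below_iff_lower_part[OF S] s(1) by blast
      then show ?thesis using below below_level[OF S] s(1) 1(1) by (metis less_asym)
    next
      case (2 t1 t2 t3)
      have "assoc_rule w' w"
        unfolding s(3) 2(3)
        by (rule nested_splits_assoc[OF S s(1,2,4-6) 2(4-6)]) (use s(7) 2(7) D(3) in simp)
      then show ?thesis using below unfolding rotation_def by (blast intro: replace_one.here)
    qed
  next
    case (2 s1 s2 s3)
    note s = 2
    show ?thesis
    proof (cases rule: Phi_opt_two_nodes[OF S \<open>admissible w' S\<close> \<open>Phi_opt w' S = _\<close>[unfolded D(2)] D(1)])
      case (1 t1 t2 t3)
      have "below S v u" using below_iff_lower_part[OF S] s(1) 1(1,2) by blast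
      moreover have "assoc_rule w w'"
        unfolding s(3) 1(3)
        by (rule nested_splits_assoc[OF S 1(1,2,4-6) s(4-6)]) (use s(7) 1(7) D(3) in simp)
      ultimately show ?thesis unfolding rotation_def by (blast intro: replace_one.here)
    next
      case (2 t1 t2 t3)
      have "v \<notin> edges (lower_part S u)" "u \<notin> edges (lower_part S v)"
        using parts_edges_disjoint[OF S] s(1,2) 2(1,2) by blast+
      then have "diverge S (snd u) (snd v)"
        using below_or_diverge[OF S s(1) 2(1) \<open>u \<noteq> v\<close>] below_iff_lower_part[OF S] s(1) 2(1) by blast
      moreover have "exchange_rule w w'"
        unfolding s(3) 2(3)
        by (rule independent_splits_exchange[OF S 2(2) s(2) s(4-6) 2(4-6)]) (use s(7) 2(7) D(3) in simp)
      ultimately show ?thesis unfolding rotation_def by (blast intro: replace_one.here)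
    qed
  qed
next
  case (inside C C' Ts x)
  note S = \<open>rooted_tree S\<close>
  obtain D' where D': "splits v u D' C'" "D' |\<notin>| Ts" "D = Node {x} (finsert D' Ts)"
    using splits_insideE[OF inside.hyps(1) inside.prems(1) inside.hyps(3) \<open>u \<noteq> v\<close>] by blast
  obtain w1 w2 where w: "w = Juxt w1 w2" and x: "x \<in> edges S"
    and adm: "admissible w1 (upper_part S x)" "admissible w2 (lower_part S x)"
    and C: "finsert C Ts = Phi_opt w1 (upper_part S x) |\<union>| Phi_opt w2 (lower_part S x)"
    by (rule Phi_opt_NodeE[OF S \<open>admissible w S\<close>, of "{x}" "finsert C Ts"]) (use \<open>Phi_opt w S = _\<close> in auto)
  obtain w1' w2' where w': "w' = Juxt w1' w2'"
    and adm': "admissible w1' (upper_part S x)" "admissible w2' (lower_part S x)"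
    and D: "finsert D' Ts = Phi_opt w1' (upper_part S x) |\<union>| Phi_opt w2' (lower_part S x)"
    by (rule Phi_opt_NodeE[OF S \<open>admissible w' S\<close>, of "{x}" "finsert D' Ts"])
      (use \<open>Phi_opt w' S = _\<close> D'(3) in auto)
  have labels: "\<Union>(labels D') = \<Union>(labels C)"
    using splits_properties(3)[OF D'(1)] splits_properties(3)[OF inside.hyps(1)] by simp
  \<comment> \<open>\<open>P\<close> is the part that contains the split node and \<open>Q\<close>
    the other one. \<open>D'\<close> falls into the same part as \<open>C\<close> because both have
    the same union of labels, and the words over \<open>Q\<close> agree by injectivity.\<close>
  have step: "rotation P u v a a' \<and> b = b'"
    if P: "rooted_tree P" "rooted_tree Q" "edges P \<inter> edges Q = {}"
      and a: "admissible a P" "admissible a' P" and b: "admissible b Q" "admissible b' Q"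
      and C: "finsert C Ts = Phi_opt a P |\<union>| Phi_opt b Q" "C |\<in>| Phi_opt a P"
      and D: "finsert D' Ts = Phi_opt a' P |\<union>| Phi_opt b' Q" for P Q a a' b b'
  proof -
    have CP: "\<Union>(labels C) \<inter> edges Q = {}" using Phi_opt_away[OF P(1) a(1) P(3) C(2)] .
    have "D' |\<notin>| Phi_opt b' Q" by (rule Phi_opt_notin[OF P(2) b(2)]) (simp add: labels CP)
    moreover have "D' |\<in>| Phi_opt a' P |\<union>| Phi_opt b' Q" unfolding D[symmetric] by simp
    ultimately have "D' |\<in>| Phi_opt a' P" by simp
    then have a'D: "Phi_opt a' P = {|D'|}" by (rule Phi_opt_member(1)[OF P(1) a(2)])
    have aC: "Phi_opt a P = {|C|}" by (rule Phi_opt_member(1)[OF P(1) a(1) C(2)])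
    have "C |\<notin>| Phi_opt b Q" by (rule Phi_opt_notin[OF P(2) b(1) CP])
    then have "Ts = Phi_opt b Q" by (rule finsert_eq_funionD[OF C(1) inside.hyps(2) aC])
    moreover have "Ts = Phi_opt b' Q"
      by (rule finsert_eq_funionD[OF D D'(2) a'D \<open>D' |\<notin>| Phi_opt b' Q\<close>])
    ultimately have "b = b'" using Phi_opt_inj[OF P(2) b] by simp
    then show ?thesis using inside.IH[OF D'(1) \<open>u \<noteq> v\<close> P(1) a(1) aC a(2) a'D] by simp
  qed
  note parts = rooted_tree_parts[OF S x]
  have disj: "edges (upper_part S x) \<inter> edges (lower_part S x) = {}"
    by (rule parts_edges_disjoint[OF S x])
  have sub: "edges (upper_part S x) \<subseteq> edges S" "edges (lower_part S x) \<subseteq> edges S"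
    using parts_edges_cover[OF S x] by blast+
  have "C |\<in>| Phi_opt w1 (upper_part S x) |\<union>| Phi_opt w2 (lower_part S x)"
    unfolding C[symmetric] by simp
  then consider "C |\<in>| Phi_opt w1 (upper_part S x)" | "C |\<in>| Phi_opt w2 (lower_part S x)" by auto
  then show ?case
  proof cases
    case 1
    from step[OF parts disj adm(1) adm'(1) adm(2) adm'(2) C this D]
    show ?thesis unfolding w w' using rotation_mono(1)[OF _ sub(1)] by simp
  next
    case 2
    have "edges (lower_part S x) \<inter> edges (upper_part S x) = {}" using disj by blast
    from step[OF parts(2,1) this adm(2) adm'(2) adm(1) adm'(1) _ 2] C D
    show ?thesis unfolding w w' using rotation_mono(2)[OF _ sub(2)] by (simp add: funion_commute)
  qed
qed

section \<open>Shortest paths\<close>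

lemma is_path_Cons2:
  "is_path T e f (e # g # p) \<longleftrightarrow> e \<in> edges T \<and> adjacent e g \<and> is_path T g f (g # p)"
  by (auto simp: is_path_def)

lemma is_shortest_path_tl:
  assumes "is_shortest_path T e f (e # g # p)"
  shows "is_shortest_path T g f (g # p)"
  unfolding is_shortest_path_def
proof (intro conjI allI impI)
  show "is_path T g f (g # p)" using assms unfolding is_shortest_path_def is_path_Cons2 by blast
  fix q assume q: "is_path T g f q"
  then obtain q' where q': "q = g # q'" unfolding is_path_def by (cases q) auto
  have "is_path T e f (e # q)"
    using assms q unfolding q' is_shortest_path_def is_path_Cons2 by blast
  then show "length (g # p) \<le> length q" using assms unfolding is_shortest_path_def by fastforce
qed

text \<open>If a solid path changed direction at \<open>y\<close>, the neighbours of
  \<open>y\<close> on the path would share a node: they would be equal or adjacent, and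
  \<open>y\<close> could be bypassed.\<close>

lemma solid_shortest_path_monotone:
  "is_shortest_path T e f p \<Longrightarrow> successively solid p \<Longrightarrow>
    successively (\<lambda>x y. snd x = fst y) p \<or> successively (\<lambda>x y. snd y = fst x) p"
proof (induction p arbitrary: e rule: induct_list012)
  case (3 x y zs)
  have ex: "e = x" using "3.prems"(1) by (simp add: is_shortest_path_def is_path_def)
  have sp: "is_shortest_path T x f (x # y # zs)" using "3.prems"(1) unfolding ex .
  have tl: "successively (\<lambda>x y. snd x = fst y) (y # zs) \<or> successively (\<lambda>x y. snd y = fst x) (y # zs)"
    using "3.IH"(2)[OF is_shortest_path_tl[OF sp]] "3.prems"(2) by simp
  show ?case
  proof (cases zs)
    case Nil
    then show ?thesis using "3.prems"(2) by (auto simp: solid_def)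
  next
    case (Cons z zs')
    have path: "x \<in> edges T" "y \<in> edges T" "z \<in> edges T" "is_path T z f (z # zs')"
      using sp unfolding is_shortest_path_def Cons is_path_Cons2 by (auto simp: is_path_def)
    have "x \<noteq> z"
      using sp path(4) unfolding is_shortest_path_def Cons by fastforce
    moreover have "\<not> adjacent x z"
    proof
      assume "adjacent x z"
      then have "is_path T x f (x # z # zs')" using path unfolding is_path_Cons2 by blast
      then show False using sp unfolding is_shortest_path_def Cons by fastforce
    qed
    ultimately have far: "{fst x, snd x} \<inter> {fst z, snd z} = {}" unfolding adjacent_def by blast
    have yz: "solid x y" using "3.prems"(2) by simp
    from tl show ?thesis
    proof
      assume a: "successively (\<lambda>x y. snd x = fst y) (y # zs)"
      then have "snd y = fst z" using Cons by simp
      have "snd y \<noteq> fst x" using \<open>snd y = fst z\<close> far by auto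
      then show ?thesis using yz a by (simp add: solid_def)
    next
      assume a: "successively (\<lambda>x y. snd y = fst x) (y # zs)"
      then have "snd z = fst y" using Cons by simp
      then have "snd x \<noteq> fst y" using far by auto
      then show ?thesis using yz a by (simp add: solid_def)
    qed
  qed
qed auto

lemma chain_below:
  assumes "successively (\<lambda>x y. snd x = fst y) (e # g # p)" "set (e # g # p) \<subseteq> edges T"
  shows "below T e (last (g # p))"
  using assms
proof (induction p arbitrary: e g)
  case Nil
  then show ?case by (simp add: below_def)
next
  case (Cons h p)
  then have "below T g (last (h # p))" "snd e = fst g" "g \<in> edges T" by auto
  then show ?case
    by (cases g) (auto simp: below_def intro: converse_rtrancl_into_rtrancl)
qed

lemma list_two_elements:
  "p \<noteq> [] \<Longrightarrow> hd p \<noteq> last p \<Longrightarrow> \<exists>x q. p = hd p # x # q"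
  by (cases p rule: remdups_adj.cases) auto

lemma solid_shortest_path_below:
  assumes p: "is_shortest_path T u v p" "successively solid p" "u \<noteq> v"
  shows "below T u v \<or> below T v u"
proof -
  have path: "p \<noteq> []" "hd p = u" "last p = v" "set p \<subseteq> edges T"
    using p(1) unfolding is_shortest_path_def is_path_def by blast+
  then obtain g q where q: "p = u # g # q" using p(3) list_two_elements[of p] by auto
  from solid_shortest_path_monotone[OF p(1,2)] show ?thesis
  proof
    assume "successively (\<lambda>x y. snd x = fst y) p"
    then show ?thesis using chain_below[of u g q T] path unfolding q by simp
  next
    assume "successively (\<lambda>x y. snd y = fst x) p"
    \<comment> \<open>An ascending path read backwards descends from \<open>v\<close> to
      \<open>u\<close>.\<close>
    then have "successively (\<lambda>x y. snd x = fst y) (rev p)" by (simp add: successively_rev)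
    moreover obtain g' q' where "rev p = v # g' # q'"
      using path p(3) list_two_elements[of "rev p"] by (auto simp: hd_rev last_rev)
    moreover have "last (rev p) = u" "set (rev p) \<subseteq> edges T" using path by (simp_all add: last_rev)
    ultimately show ?thesis using chain_below[of v g' q' T] by simp
  qed
qed

lemma below_path:
  assumes T: "rooted_tree T" and v: "v \<in> edges T" and "u \<in> edges T" "below T u v"
  shows "\<exists>p. is_path T u v p \<and> length p = Suc (level T v - level T u)"
proof -
  \<comment> \<open>The strict inequality of levels is carried through the induction because
    subtraction on naturals is truncated.\<close>
  have "\<exists>p. is_path T u (a, b) p \<and> length p = Suc (level T (a, b) - level T u) \<and> level T u < level T (a, b)"
    if "(snd u, a) \<in> (edges T)\<^sup>*" "(a, b) \<in> edges T" for a b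
    using that
  proof (induction arbitrary: b)
    case base
    have "adjacent u (snd u, b)"
      using depth_child[OF T base] unfolding adjacent_def by (cases u) auto
    then have "is_path T u (snd u, b) [u, (snd u, b)]"
      using base assms(3) by (simp add: is_path_def)
    then show ?case using depth_child[OF T base] by (intro exI[of _ "[u, (snd u, b)]"]) (simp add: level_def)
  next
    case (step a' a)
    obtain p where p: "is_path T u (a', a) p" "length p = Suc (level T (a', a) - level T u)"
        "level T u < level T (a', a)"
      using step.IH[OF step.hyps(2)] by blast
    have "adjacent (a', a) (a, b)"
      using depth_child[OF T step.prems] unfolding adjacent_def by auto
    then have "is_path T u (a, b) (p @ [(a, b)])"
      using p(1) step.prems by (auto simp: is_path_def successively_append_iff)
    then show ?case using p(2,3) depth_child[OF T step.prems]
      by (intro exI[of _ "p @ [(a, b)]"]) (auto simp: level_def)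
  qed
  then show ?thesis using assms(4) v unfolding below_def by (cases v) auto
qed

text \<open>Along a path the level changes by at most one per step and not at all along dashed edges,
  so a path as short as the level difference has no dashed edge.\<close>

lemma level_adjacent:
  assumes T: "rooted_tree T" and ef: "e \<in> edges T" "f \<in> edges T" "adjacent e f"
  shows "level T f \<le> Suc (level T e)" "\<not> solid e f \<Longrightarrow> level T f = level T e"
proof -
  obtain a b c d where e: "e = (a, b)" and f: "f = (c, d)" by (cases e, cases f)
  have depths: "depth T b = Suc (depth T a)" "depth T d = Suc (depth T c)"
    using ef depth_child[OF T] unfolding e f by blast+
  have "b \<noteq> d" using rooted_tree_parent_unique[OF T, of a b c] ef unfolding e f adjacent_def by auto
  then have "a = c \<or> a = d \<or> b = c" using ef(3) unfolding e f adjacent_def by auto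
  then show "level T f \<le> Suc (level T e)" "\<not> solid e f \<Longrightarrow> level T f = level T e"
    using depths by (auto simp: level_def solid_def e f)
qed

text \<open>The length counts vertices, one more than the number of steps, hence the strict bound; a
  dashed step gains no level and improves the bound by one.\<close>

lemma path_level:
  assumes T: "rooted_tree T"
  shows "is_path T e f p \<Longrightarrow> level T f < level T e + length p \<and>
    (\<not> successively solid p \<longrightarrow> Suc (level T f) < level T e + length p)"
proof (induction p arbitrary: e rule: induct_list012)
  case (3 x y zs)
  have ex: "e = x" using "3.prems" by (simp add: is_path_def)
  have path: "x \<in> edges T" "adjacent x y" "is_path T y f (y # zs)"
    using "3.prems" unfolding ex is_path_Cons2 by blast+
  then have "y \<in> edges T" by (simp add: is_path_def)
  note step = level_adjacent[OF T path(1) this path(2)]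
  show ?case
    using "3.IH"(2)[OF path(3)] step unfolding ex by (cases "solid x y") auto
qed (auto simp: is_path_def)

lemma below_shortest_path_solid:
  assumes T: "rooted_tree T" and p: "is_shortest_path T u v p" and "u \<in> edges T" "v \<in> edges T" "below T u v"
  shows "successively solid p"
proof (rule ccontr)
  assume "\<not> successively solid p"
  then have "Suc (level T v) < level T u + length p"
    using path_level[OF T, of u v p] p unfolding is_shortest_path_def by blast
  moreover obtain q where "is_path T u v q" "length q = Suc (level T v - level T u)"
    using below_path[OF T] assms(3-5) by blast
  then have "length p \<le> Suc (level T v - level T u)" using p unfolding is_shortest_path_def by fastforce
  moreover have "level T u < level T v" by (rule below_level[OF T assms(4,5)])
  ultimately show False by linarith
qed

lemma is_shortest_path_rev:
  assumes "is_shortest_path T u v p"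
  shows "is_shortest_path T v u (rev p)"
proof -
  have sym: "adjacent x y = adjacent y x" for x y :: "'a \<times> 'a" unfolding adjacent_def by auto
  have rev: "is_path T b a (rev q)" if "is_path T a b q" for a b q
    using that sym unfolding is_path_def by (auto simp: hd_rev last_rev successively_rev)
  show ?thesis using assms rev unfolding is_shortest_path_def by (metis length_rev)
qed

lemma successively_solid_rev: "successively solid (rev p) \<longleftrightarrow> successively solid p"
proof -
  have "solid x y = solid y x" for x y :: "'a \<times> 'a" unfolding solid_def by auto
  then show ?thesis by (simp add: successively_rev)
qed

theorem theorem2:
  fixes T :: "'a rtree"
    and E V_u V_v :: "('a \<times> 'a) set ltree"
    and u v :: "'a \<times> 'a"
    and p :: "('a \<times> 'a) list"
  assumes "rooted_tree T"
    and "edges T \<noteq> {}"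
    and "construct (edge_graph T) E"
    and "u \<noteq> v"
    and "{u, v} \<in> labels E"
    and "\<forall>L \<in> labels E - {{u, v}}. is_singleton L"
    and "construction (edge_graph T) V_u"
    and "construct_le (edge_graph T) V_u E"
    and "parent_label V_u {u} {v}"
    and "construction (edge_graph T) V_v"
    and "construct_le (edge_graph T) V_v E"
    and "parent_label V_v {v} {u}"
    and "is_shortest_path T u v p"
  shows "(successively solid p \<longrightarrow>
            level T u \<noteq> level T v \<and>
            (level T u < level T v \<longrightarrow>
               replace_one assoc_rule (Phi_inv T V_v) (Phi_inv T V_u)) \<and>
            (level T v < level T u \<longrightarrow>
               replace_one assoc_rule (Phi_inv T V_u) (Phi_inv T V_v))) \<and>
         (\<not> successively solid p \<longrightarrow>
            replace_one exchange_rule (Phi_inv T V_u) (Phi_inv T V_v) \<or>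
            replace_one exchange_rule (Phi_inv T V_v) (Phi_inv T V_u))"
proof -
  note T = \<open>rooted_tree T\<close> and p = \<open>is_shortest_path T u v p\<close>
  \<comment> \<open>Labels of a construct are subsets of the ground set, here the set of edges of
    \<open>T\<close>.\<close>
  have uv: "u \<in> edges T" "v \<in> edges T"
    using construct_labels[OF assms(3)] assms(5)
    unfolding labels_within_def edge_graph_eq_line_graph Union_line_graph by (metis insert_subset)+
  have split_u: "splits u v V_u E"
    by (rule construct_le_construction_splits[OF assms(8,6,5,4,7,9)])
  have split_v: "splits v u V_v E"
    by (rule construct_le_construction_splits[OF assms(11) _ _ assms(4)[symmetric] assms(10,12)])
      (use assms(5,6) in \<open>simp_all add: insert_commute\<close>)
  have "rotation T u v (Phi_inv T V_u) (Phi_inv T V_v)"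
    by (rule splits_rotation[OF split_u split_v assms(4) T])
      (rule Phi_inv_construction[OF T assms(2,7)] Phi_inv_construction[OF T assms(2,10)])+
  then show ?thesis
    unfolding rotation_def
  proof (elim disjE conjE)
    assume "below T u v" "replace_one assoc_rule (Phi_inv T V_v) (Phi_inv T V_u)"
    moreover from this have "successively solid p" "level T u < level T v"
      using below_shortest_path_solid[OF T p uv] below_level[OF T uv(2)] by blast+
    ultimately show ?thesis by simp
  next
    assume "below T v u" "replace_one assoc_rule (Phi_inv T V_u) (Phi_inv T V_v)"
    moreover from this have "successively solid p" "level T v < level T u"
      using below_shortest_path_solid[OF T is_shortest_path_rev[OF p] uv(2,1)] below_level[OF T uv(1)]
      unfolding successively_solid_rev by blast+
    ultimately show ?thesis by simp
  next
    assume d: "diverge T (snd u) (snd v)"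
      and ex: "replace_one exchange_rule (Phi_inv T V_u) (Phi_inv T V_v)"
    \<comment> \<open>Extending a walk to \<open>fst v\<close> by the edge \<open>v\<close> would
      make \<open>snd u\<close> an ancestor of \<open>snd v\<close>, contrary to divergence;
      likewise with \<open>u\<close> and \<open>v\<close> exchanged.\<close>
    have "\<not> below T u v" "\<not> below T v u"
      using diverge_not_ancestor[OF T d] diverge_not_ancestor[OF T diverge_sym[OF d]] uv
      unfolding below_def by (metis prod.collapse rtrancl.rtrancl_into_rtrancl)+
    then have "\<not> successively solid p"
      using solid_shortest_path_below[OF p _ assms(4)] by blast
    then show ?thesis using ex by simp
  qed
qed

end
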